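(* Let $D=(V,A)$ be a directed graph of order $n\geq 6$ and let $W\subseteq V$. Suppose that every vertex $x\in W$ satisfies $a^+(x)+a^-(x)\geq (3n-3)/2$, where $a^+(x)$ and $a^-(x)$ denote the out-degree and in-degree of $x$ in $D$. Then for any integers $n_1\geq 3$ and $n_2\geq 3$ with $n_1+n_2=|W|$, $D$ contains two vertex-disjoint directed cycles $C_1$ and $C_2$ such that $|V(C_1)\cap W|=n_1$ and $|V(C_2)\cap W|=n_2$.
   Context: Directed graphs are finite and strict: no loops and no multiple arcs with the same direction, but for two distinct vertices $x,y$ both arcs $(x,y)$ and $(y,x)$ may be present. The degree of a vertex is the sum of its out-degree and in-degree, so it can be as large as $2(n-1)$. *)

theory Defs
  imports Complex_Main "Graph_Theory.Graph_Theory"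
begin

definition cycle_verts :: "('a, 'b) pre_digraph \<Rightarrow> 'b awalk \<Rightarrow> 'a set" where
  "cycle_verts G c = tail G ` set c \<union> head G ` set c"

lemma (in wf_digraph) set_awalk_verts_eq_cycle_verts:
  assumes "awalk u c v" "c \<noteq> []"
  shows "set (awalk_verts u c) = cycle_verts G c"
proof -
  have "set (awalk_verts u c) = insert (tail G (hd c)) (head G ` set c)"
    using assms awalk_verts_conv'[of u c v] by (simp add: awalk_def)
  moreover have "set (awalk_verts u c) = insert (head G (last c)) (tail G ` set c)"
    using assms by (simp add: awalk_verts_conv)
  ultimately show ?thesis
    using assms(2) by (auto simp: cycle_verts_def)
qed

end

theory Submission
  imports Defs
begin

text \<open>
  Call an absent arc missing. Every vertex of $W$ misses at most $k = (n-1)/2$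
  (rounded down) arcs. Arcs avoiding $W$ are discarded, so the remaining vertices form an
  independent set.

  The main tool is a Ghouila-Houri type statement: if a target set is mutually reachable inside
  $A$ and each target misses at most $|A| - 2$ arcs of $A$, then some cycle in $A$ covers it.

  Assume $n_1 \le n_2$ and $n_1 + k + 2 \le n$. Among the shortest cycles $C$ with exactly $n_1$
  vertices in $W$, choose one for which some strong component of $D - C$ contains as many
  vertices of $W$ as possible. If a vertex $x$ of $W$ lies outside the component of $y$, then
  counting missing arcs yields a vertex $z$ of $C$ that can be replaced by $x$ and that is joined
  to $y$ in both directions; the exchange enlarges the component of $y$. Hence $W - C$ is mutually
  reachable in $D - C$. Each non-$W$ vertex of $C$ forces two missing arcs between $C$ and every
  vertex of $W - C$, as $C$ cannot be shortened; this gives the degree bound in $D - C$, and a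
  cycle through $W - C$ exists.

  In the remaining nearly balanced cases one splits $W$ (up to one vertex) into two equal halves
  with the largest number of missing arcs between them. If one half does not have a Hamiltonian
  cycle for the above reasons, all estimates are equalities, and then the extra vertex is joined
  to every vertex of this half in both directions.
\<close>

section \<open>Cycles through a prescribed set\<close>

text \<open>Missing at most \<open>card A - 2\<close> of the \<open>2 * (card A - 1)\<close>
  possible arcs means having degree at least \<open>card A\<close> in \<open>A\<close>. Missing arcs
  are counted because the budget \<open>k\<close> splits between a cycle and its complement. Two
  vertices in different strong components of \<open>A\<close> together miss at least
  \<open>card A\<close> arcs inside \<open>A\<close>; if \<open>A\<close> is the complement of
  \<open>C\<close>, then \<open>2 * k < n\<close> leaves fewer missing arcs towards \<open>C\<close>
  than \<open>C\<close> has vertices, and this shortage makes an exchange possible. Discarding arcs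
  that avoid \<open>W\<close> changes no degree of a vertex of \<open>W\<close> and forbids two
  consecutive vertices outside \<open>W\<close> on a cycle; so trading two consecutive vertices, one
  of them outside \<open>W\<close>, for a vertex of \<open>W\<close> keeps the count and shortens
  the cycle. The number \<open>n1 + k + 2\<close> is what the degree bound for the remainder demands
  when \<open>C\<close> lies inside \<open>W\<close>. If \<open>n\<close> is smaller,
  \<open>n1\<close> and \<open>n2\<close> are \<open>k\<close> or \<open>k + 1\<close>, and the
  remainder of a cycle chosen on its own may be too sparse. Both vertex sets are then chosen at
  once: maximizing the missing arcs between them spends the budget across and leaves the halves
  dense.\<close>

definition induced_rel :: "('a \<Rightarrow> 'a \<Rightarrow> bool) \<Rightarrow> 'a set \<Rightarrow> ('a \<times> 'a) set" where
  "induced_rel E A = {(a, b). a \<in> A \<and> b \<in> A \<and> E a b}"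

lemma induced_rel_converse: "(induced_rel E A)\<inverse> = induced_rel (\<lambda>x y. E y x) A"
  by (auto simp: induced_rel_def)

text \<open>The walk is restarted whenever it meets \<open>C\<close> and truncated whenever it
  repeats a vertex, so only a simple final piece outside \<open>C\<close> survives.\<close>

lemma path_leaving_set:
  assumes "(s, x) \<in> (induced_rel E A)\<^sup>*" "s \<in> C" "x \<notin> C"
  shows "\<exists>z\<in>C. \<exists>ps. ps \<noteq> [] \<and> distinct ps \<and> successively E ps \<and> set ps \<subseteq> A - C \<and>
           E z (hd ps) \<and> last ps = x"
  using assms(1,3)
proof (induction rule: rtrancl_induct)
  case base
  with assms(2) show ?case by blast
next
  case (step v v')
  have E: "E v v'" "v' \<in> A" using step.hyps(2) by (auto simp: induced_rel_def)
  show ?case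
  proof (cases "v \<in> C")
    case True
    then show ?thesis using E step.prems by (intro bexI[of _ v] exI[of _ "[v']"]) auto
  next
    case False
    with step.IH obtain z ps where z: "z \<in> C" and ps: "ps \<noteq> []" "distinct ps"
      "successively E ps" "set ps \<subseteq> A - C" "E z (hd ps)" "last ps = v" by blast
    show ?thesis
    proof (cases "v' \<in> set ps")
      case True
      then obtain as bs where ab: "ps = as @ v' # bs" by (meson split_list)
      have "distinct (as @ [v'])" "successively E (as @ [v'])" "E z (hd (as @ [v']))"
        "set (as @ [v']) \<subseteq> A - C"
        using ps ab by (auto simp: successively_append_iff hd_append split: if_splits)
      then show ?thesis using z by (intro bexI[of _ z] exI[of _ "as @ [v']"]) auto
    next
      case False
      have "successively E (ps @ [v'])" using ps E by (auto simp: successively_append_iff)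
      then show ?thesis using z ps E False step.prems
        by (intro bexI[of _ z] exI[of _ "ps @ [v']"]) auto
    qed
  qed
qed

lemma path_entering_set:
  assumes "(x, s) \<in> (induced_rel E A)\<^sup>*" "s \<in> C" "x \<notin> C"
  shows "\<exists>z\<in>C. \<exists>ps. ps \<noteq> [] \<and> distinct ps \<and> successively E ps \<and> set ps \<subseteq> A - C \<and>
           hd ps = x \<and> E (last ps) z"
proof -
  have "(s, x) \<in> (induced_rel (\<lambda>x y. E y x) A)\<^sup>*"
    using assms(1) by (metis induced_rel_converse rtrancl_converseI)
  from path_leaving_set[OF this assms(2,3)] obtain z ps where
    "z \<in> C" "ps \<noteq> []" "distinct ps" "successively (\<lambda>x y. E y x) ps" "set ps \<subseteq> A - C"
    "E (hd ps) z" "last ps = x" by blast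
  then show ?thesis
    by (intro bexI[of _ z] exI[of _ "rev ps"]) (auto simp: hd_rev last_rev)
qed

lemma card_Int_replace:
  assumes "finite Z" "R \<subseteq> Z" "x \<in> W" "x \<notin> Z"
  shows "card (W \<inter> insert x (Z - R)) + card (W \<inter> R) = card (W \<inter> Z) + 1"
proof -
  have "card (W \<inter> insert x (Z - R)) = card (insert x (W \<inter> (Z - R)))"
    using assms by (intro arg_cong[of _ _ card]) auto
  also have "\<dots> = card (W \<inter> (Z - R)) + 1" using assms by (subst card_insert_disjoint) auto
  finally have "card (W \<inter> insert x (Z - R)) = card (W \<inter> (Z - R)) + 1" .
  moreover have "card (W \<inter> Z) = card (W \<inter> (Z - R)) + card (W \<inter> R)"
    using assms by (subst card_Un_disjoint[symmetric]) (auto intro: arg_cong[of _ _ card] finite_subset)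
  ultimately show ?thesis by simp
qed

text \<open>Deleting a largest value never raises the average; this is repeated until
  \<open>q\<close> elements are left. Stated without division, so that \<open>q = 0\<close> needs no
  special form.\<close>

lemma exists_subset_below_average:
  fixes g :: "'a \<Rightarrow> int"
  assumes "finite B" "q \<le> card B"
  shows "\<exists>R\<subseteq>B. card R = q \<and> int (card B) * sum g R \<le> int q * sum g B"
  using assms
proof (induction "card B - q" arbitrary: B)
  case 0
  then show ?case by (intro exI[of _ B]) auto
next
  case (Suc d)
  let ?p = "int (card B)"
  have "B \<noteq> {}" using Suc by auto
  then obtain b where b: "b \<in> B" "\<And>a. a \<in> B \<Longrightarrow> g a \<le> g b"
    using Max_in[of "g ` B"] Max_ge[of "g ` B"] Suc.prems(1) by fastforce
  have card: "card (B - {b}) = card B - 1" using b Suc.prems by simp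
  obtain R where R: "R \<subseteq> B - {b}" "card R = q" "int (card (B - {b})) * sum g R \<le> int q * sum g (B - {b})"
  proof -
    have "d = card (B - {b}) - q" "q \<le> card (B - {b})" using Suc.hyps(2) card by linarith+
    then show ?thesis using that Suc.hyps(1)[of "B - {b}"] Suc.prems(1) by blast
  qed
  have G: "sum g (B - {b}) = sum g B - g b" using b Suc.prems by (simp add: sum_diff1)
  have avg: "sum g B \<le> ?p * g b" using sum_bounded_above[of B g "g b"] b by simp
  have "?p * sum g R \<le> int q * sum g B"
  proof (cases "card B = 1")
    case True
    then have "q = 0" using Suc.hyps(2) by simp
    then have "R = {}" using R Suc.prems finite_subset[OF R(1)] by simp
    then show ?thesis using \<open>q = 0\<close> by simp
  next
    case False
    moreover have "card B > 0" using Suc.prems(1) \<open>B \<noteq> {}\<close> by (simp add: card_gt_0_iff)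
    ultimately have p: "?p - 1 > 0" by linarith
    have "(?p - 1) * sum g R \<le> int q * (sum g B - g b)"
      using R(3) card G p by (simp add: of_nat_diff)
    then have "?p * ((?p - 1) * sum g R) \<le> ?p * (int q * (sum g B - g b))" by (intro mult_left_mono) auto
    also have "\<dots> = int q * (?p * sum g B) - int q * (?p * g b)" by (simp add: algebra_simps)
    also have "\<dots> \<le> int q * (?p * sum g B) - int q * sum g B"
      using mult_left_mono[OF avg, of "int q"] by simp
    also have "\<dots> = (?p - 1) * (int q * sum g B)" by (simp add: algebra_simps)
    finally have "(?p - 1) * (?p * sum g R) \<le> (?p - 1) * (int q * sum g B)" by (simp add: algebra_simps)
    then show ?thesis using p by (simp only: mult_le_cancel_left_pos)
  qed
  then show ?case using R by blast
qed

locale loopfree =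
  fixes E :: "'a \<Rightarrow> 'a \<Rightarrow> bool"
  assumes irrefl: "\<not> E x x"
begin

section \<open>Arc counts and cyclic lists\<close>

definition present :: "'a \<Rightarrow> 'a \<Rightarrow> nat" where
  "present x y = of_bool (E x y) + of_bool (E y x)"

definition missing :: "'a \<Rightarrow> 'a \<Rightarrow> nat" where
  "missing x y = of_bool (\<not> E x y) + of_bool (\<not> E y x)"

text \<open>Leaving out \<open>x\<close> lets the same notion serve for sets that contain
  \<open>x\<close> and for sets that do not, and makes it additive over disjoint unions.\<close>

definition missing_deg :: "'a \<Rightarrow> 'a set \<Rightarrow> nat" where
  "missing_deg x A = (\<Sum>y\<in>A - {x}. missing x y)"

text \<open>A single vertex is excluded by irreflexivity, while a pair joined in both directions is
  allowed; such pairs start the extremal choices below.\<close>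

definition cycle_list :: "'a list \<Rightarrow> bool" where
  "cycle_list zs \<longleftrightarrow> zs \<noteq> [] \<and> distinct zs \<and> successively E zs \<and> E (last zs) (hd zs)"

lemma missing_commute: "missing x y = missing y x"
  by (simp add: missing_def)

lemma present_commute: "present x y = present y x"
  by (simp add: present_def)

lemma present_le_2: "present x y \<le> 2"
  by (simp add: present_def)

lemma present_plus_missing: "present x y + missing x y = 2"
  by (simp add: present_def missing_def)

lemma missing_eq_0_iff: "missing x y = 0 \<longleftrightarrow> E x y \<and> E y x"
  by (simp add: missing_def)

lemma present_eq_0_iff: "present x y = 0 \<longleftrightarrow> \<not> E x y \<and> \<not> E y x"
  by (simp add: present_def)

lemma cycI_append:
  assumes "cycle_list (xs @ ys)" shows "cycle_list (ys @ xs)"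
  using assms by (cases "xs = []"; cases "ys = []")
    (auto simp: cycle_list_def successively_append_iff)

lemma cycle_list_rotate: "cycle_list zs \<Longrightarrow> cycle_list (rotate i zs)"
  by (metis append_take_drop_id cycI_append rotate_drop_take)

lemma cycle_list_insert:
  assumes "cycle_list (xs @ ys)" "xs \<noteq> []" "ys \<noteq> []" "v \<notin> set xs \<union> set ys" "E (last xs) v" "E v (hd ys)"
  shows "cycle_list (xs @ v # ys)"
  using assms by (auto simp: cycle_list_def successively_append_iff successively_Cons)

lemma cycle_list_obtain_hd:
  assumes "cycle_list zs" "z \<in> set zs"
  obtains zs' where "cycle_list zs'" "set zs' = set zs" "hd zs' = z" "length zs' = length zs"
proof -
  from assms(2) obtain xs ys where "zs = xs @ z # ys" by (meson split_list)
  then show ?thesis using that[of "z # ys @ xs"] cycI_append[of xs "z # ys"] assms(1) by auto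
qed

lemma missing_deg_present:
  assumes "finite A" "x \<in> A"
  shows "missing_deg x A + (\<Sum>y\<in>A - {x}. present x y) = 2 * (card A - 1)"
proof -
  have "missing_deg x A + (\<Sum>y\<in>A - {x}. present x y) = (\<Sum>y\<in>A - {x}. 2)"
    unfolding missing_deg_def sum.distrib[symmetric]
    by (intro sum.cong refl) (use present_plus_missing in \<open>simp add: add.commute\<close>)
  then show ?thesis using assms by simp
qed

text \<open>Present and missing arcs at a vertex of \<open>A\<close> add up to
  \<open>2 * (card A - 1)\<close>, so both degrees are at least \<open>card A\<close>; the arcs
  between \<open>x\<close> and \<open>y\<close> occur in both, hence the factor 2.\<close>

lemma present_pair_sum:
  assumes A: "finite A" "x \<in> A" "y \<in> A" "x \<noteq> y"
    and d: "missing_deg x A + 2 \<le> card A" "missing_deg y A + 2 \<le> card A"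
  shows "2 * card A \<le> (\<Sum>w\<in>A - {x, y}. present x w + present y w) + 2 * present x y"
proof -
  have "(\<Sum>w\<in>A - {x}. present x w) = present x y + (\<Sum>w\<in>A - {x, y}. present x w)"
    using A sum.remove[of "A - {x}" y "present x"] by (simp add: Diff_insert2[symmetric])
  moreover have "(\<Sum>w\<in>A - {y}. present y w) = present x y + (\<Sum>w\<in>A - {x, y}. present y w)"
    using A sum.remove[of "A - {y}" x "present y"] 
    by (simp add: Diff_insert2[symmetric] present_commute insert_commute)
  moreover have "card A \<le> (\<Sum>w\<in>A - {x}. present x w)" "card A \<le> (\<Sum>w\<in>A - {y}. present y w)"
    using missing_deg_present[OF A(1,2)] missing_deg_present[OF A(1,3)] d by linarith+
  ultimately show ?thesis by (simp add: sum.distrib)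
qed

lemma digon_exists:
  assumes "finite A" "x \<in> A" "missing_deg x A + 2 \<le> card A"
  shows "\<exists>v\<in>A. v \<noteq> x \<and> missing x v = 0"
proof (rule ccontr)
  assume "\<not> ?thesis"
  then have "(\<Sum>y\<in>A - {x}. 1) \<le> missing_deg x A"
    unfolding missing_deg_def by (intro sum_mono) (auto simp: Suc_le_eq)
  then show False using assms by simp
qed

lemma cycle_list_pair: "missing x v = 0 \<Longrightarrow> x \<noteq> v \<Longrightarrow> cycle_list [x, v]"
  by (simp add: cycle_list_def missing_eq_0_iff)

text \<open>For consecutive \<open>q\<close>, \<open>q'\<close> at most one of the arcs from
  \<open>q\<close> to \<open>v\<close> and from \<open>v\<close> to \<open>q'\<close> is present.
  This accounts for all arcs except those from \<open>v\<close> to the first vertex and from the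
  last vertex to \<open>v\<close>.\<close>

lemma noninsertable_path:
  assumes "qs \<noteq> []" "distinct qs"
    and "\<And>as bs. qs = as @ bs \<Longrightarrow> as \<noteq> [] \<Longrightarrow> bs \<noteq> [] \<Longrightarrow> \<not> (E (last as) v \<and> E v (hd bs))"
  shows "(\<Sum>q\<in>set qs. present v q) + 1 \<le> length qs + of_bool (E v (hd qs)) + of_bool (E (last qs) v)"
  using assms
proof (induction qs)
  case Nil
  then show ?case by simp
next
  case (Cons q qs)
  show ?case
  proof (cases "qs = []")
    case True
    then show ?thesis by (simp add: present_def)
  next
    case False
    have "\<not> (E (last as) v \<and> E v (hd bs))" if "qs = as @ bs" "as \<noteq> []" "bs \<noteq> []" for as bs
      using Cons.prems(3)[of "q # as" bs] that by simp
    then have "(\<Sum>q\<in>set qs. present v q) + 1 \<le> length qs + of_bool (E v (hd qs)) + of_bool (E (last qs) v)"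
      using Cons.prems(2) False by (intro Cons.IH) auto
    moreover have "\<not> (E q v \<and> E v (hd qs))"
      using Cons.prems(3)[of "[q]" qs] False by simp
    moreover have "(\<Sum>q\<in>set (q # qs). present v q) = present v q + (\<Sum>q\<in>set qs. present v q)"
      using Cons.prems(2) by simp
    ultimately show ?thesis using False
      by (cases "E v (hd qs)"; cases "E q v") (auto simp: present_def[of v q])
  qed
qed

text \<open>The ends \<open>z\<close> and \<open>z'\<close> may coincide. The last condition makes a
  detour worthwhile: it picks up a target that \<open>C\<close> lacks when \<open>C\<close> is the
  vertex set of a cycle.\<close>

definition bypass :: "'a set \<Rightarrow> 'a set \<Rightarrow> 'a set \<Rightarrow> 'a \<Rightarrow> 'a list \<Rightarrow> 'a \<Rightarrow> bool" where
  "bypass A S C z ps z' \<longleftrightarrow> ps \<noteq> [] \<and> distinct ps \<and> successively E ps \<and> set ps \<subseteq> A - C \<and>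
     E z (hd ps) \<and> E (last ps) z' \<and> S \<inter> set ps \<noteq> {}"

text \<open>Without a bypass, targets outside \<open>C\<close> have no arcs at all to or from
  \<open>C\<close>, so they communicate with \<open>C\<close> only through vertices outside
  \<open>S\<close>. One such target and a target in \<open>C\<close> then have almost no common
  connections, against their degrees.\<close>

lemma bypass_exists:
  assumes fin: "finite A" and SA: "S \<subseteq> A"
    and indep: "\<And>u v. u \<in> A \<Longrightarrow> v \<in> A \<Longrightarrow> E u v \<Longrightarrow> u \<in> S \<or> v \<in> S"
    and deg: "\<And>x. x \<in> S \<Longrightarrow> missing_deg x A + 2 \<le> card A"
    and strong: "\<And>x y. x \<in> S \<Longrightarrow> y \<in> S \<Longrightarrow> (x, y) \<in> (induced_rel E A)\<^sup>*"
    and C: "C \<subseteq> A" "S \<inter> C \<noteq> {}" "\<not> S \<subseteq> C"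
  shows "\<exists>z\<in>C. \<exists>z'\<in>C. \<exists>ps. bypass A S C z ps z'"
proof (rule ccontr)
  assume "\<not> ?thesis"
  then have NB: "\<not> bypass A S C z ps z'" if "z \<in> C" "z' \<in> C" for z z' ps
    using that by blast
  obtain y where y: "y \<in> S" "y \<in> C" using C(2) by blast
  define X where "X = S - C"
  have into: "\<exists>z\<in>C. \<exists>ps. ps \<noteq> [] \<and> distinct ps \<and> successively E ps \<and> set ps \<subseteq> A - C \<and>
           E z (hd ps) \<and> last ps = x" if "x \<in> X" for x
    using that path_leaving_set[OF strong[OF y(1), of x] y(2)] unfolding X_def by blast
  have outof: "\<exists>z\<in>C. \<exists>ps. ps \<noteq> [] \<and> distinct ps \<and> successively E ps \<and> set ps \<subseteq> A - C \<and>
           hd ps = x \<and> E (last ps) z" if "x \<in> X" for x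
    using that path_entering_set[OF strong[OF _ y(1), of x] y(2)] unfolding X_def by blast
  \<comment> \<open>Reachability provides a path from \<open>x\<close> back to \<open>C\<close>;
    entered by the arc from \<open>z\<close>, it would be a bypass.\<close>
  have noin: "\<not> E z x" if xz: "x \<in> X" "z \<in> C" for x z
  proof
    assume "E z x"
    from outof[OF xz(1)] obtain z' ps where z': "z' \<in> C" and ps: "ps \<noteq> []" "distinct ps"
      "successively E ps" "set ps \<subseteq> A - C" "hd ps = x" "E (last ps) z'" by blast
    have "x \<in> S \<inter> set ps" using ps xz unfolding X_def by (metis DiffD1 IntI hd_in_set)
    then have "bypass A S C z ps z'" unfolding bypass_def using ps \<open>E z x\<close> by blast
    then show False using NB z' xz by blast
  qed
  have noout: "\<not> E x z" if xz: "x \<in> X" "z \<in> C" for x z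
  proof
    assume "E x z"
    from into[OF xz(1)] obtain z' ps where z': "z' \<in> C" and ps: "ps \<noteq> []" "distinct ps"
      "successively E ps" "set ps \<subseteq> A - C" "E z' (hd ps)" "last ps = x" by blast
    have "x \<in> S \<inter> set ps" using ps xz unfolding X_def by (metis DiffD1 IntI last_in_set)
    then have "bypass A S C z' ps z" unfolding bypass_def using ps \<open>E x z\<close> by blast
    then show False using NB z' xz by blast
  qed
  \<comment> \<open>The first vertex on a path leaving \<open>C\<close> that has a two-step path back to \<open>C\<close> can use
    only the first vertex of that path for it, so this vertex and \<open>y\<close> have too few arcs.\<close>
  define Out where "Out x w \<longleftrightarrow> w \<in> A - C \<and> E x w \<and> (\<exists>z\<in>C. E w z)" for x w
  \<comment> \<open>The vertex \<open>w\<close> sends an arc to \<open>C\<close>, so it is no target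
    by \<open>noout\<close>; independence then makes \<open>x\<close> one.\<close>
  have Out_X: "x \<in> X" if "x \<in> A - C" "Out x w" for x w
    using that noout indep[of x w] unfolding Out_def X_def by blast
  obtain x0 where x0: "x0 \<in> X" using C(3) unfolding X_def by blast
  have "\<exists>x\<in>X. \<exists>w. Out x w"
  proof -
    from outof[OF x0] obtain z' ps where z': "z' \<in> C" and ps: "ps \<noteq> []" 
      "successively E ps" "set ps \<subseteq> A - C" "hd ps = x0" "E (last ps) z'" by blast
    obtain qs w where qw: "ps = qs @ [w]" using ps(1) by (metis rev_exhaust)
    have "qs \<noteq> []" using qw ps noout[OF x0 z'] by auto
    then have "last qs \<in> A - C" using qw ps(3) last_in_set by fastforce
    moreover have "Out (last qs) w"
      using qw ps z' \<open>qs \<noteq> []\<close> by (auto simp: Out_def successively_append_iff)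
    ultimately show ?thesis using Out_X by blast
  qed
  then obtain x1 where x1: "x1 \<in> X" "\<exists>w. Out x1 w" by blast
  define good where "good as \<longleftrightarrow> as \<noteq> [] \<and> distinct as \<and> successively E as \<and> set as \<subseteq> A - C \<and>
     (\<exists>z\<in>C. E z (hd as)) \<and> (\<exists>w. Out (last as) w)" for as
  have "\<exists>as. good as"
    using into[OF x1(1)] x1(2) unfolding good_def by blast
  then obtain as where as: "good as" and asmin: "\<And>bs. good bs \<Longrightarrow> length as \<le> length bs"
    using ex_has_least_nat[of good _ length] by blast
  define x where "x = last as"
  have asD: "as \<noteq> []" "distinct as" "successively E as" "set as \<subseteq> A - C" "\<exists>w. Out x w"
    and "\<exists>z\<in>C. E z (hd as)"
    using as unfolding good_def x_def by blast+
  then obtain z where z: "z \<in> C" "E z (hd as)" by blast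
  have xas: "x \<in> set as" using asD by (simp add: x_def)
  have xX: "x \<in> X" using Out_X asD xas by blast
  then have xS: "x \<in> S" "x \<notin> C" "x \<in> A" using SA unfolding X_def by auto
  \<comment> \<open>A vertex \<open>w\<close> off the path would prolong it to a bypass. If
    \<open>w\<close> is on the path but not first, its predecessor has the outgoing two-step path,
    so a proper prefix is already \<open>good\<close>.\<close>
  have Out_hd: "w = hd as" if w: "Out x w" for w
  proof -
    obtain z' where z': "z' \<in> C" "E w z'" and w': "w \<in> A - C" "E x w" using w unfolding Out_def by blast
    have wS: "w \<notin> S" using noout[OF _ z'(1), of w] z' w' unfolding X_def by blast
    have "w \<in> set as"
    proof (rule ccontr)
      assume "w \<notin> set as"
      then have "bypass A S C z (as @ [w]) z'"
        unfolding bypass_def using asD z w' z' xS xas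
        by (auto simp: successively_append_iff x_def)
      then show False using NB z z' by blast
    qed
    then obtain a1 a2 where a: "as = a1 @ w # a2" by (meson split_list)
    have "a2 \<noteq> []" using a xS wS by (auto simp: x_def)
    have "a1 = []"
    proof (rule ccontr)
      assume "a1 \<noteq> []"
      have "Out (last a1) w" using a asD z' w' \<open>a1 \<noteq> []\<close>
        by (auto simp: Out_def successively_append_iff)
      then have "good a1" unfolding good_def using a asD z \<open>a1 \<noteq> []\<close>
        by (auto simp: successively_append_iff)
      then show False using asmin[of a1] a by simp
    qed
    then show ?thesis using a by simp
  qed
  define w1 where "w1 = hd as"
  have w1: "Out x w1" using asD(5) Out_hd unfolding w1_def by blast
  have w1S: "w1 \<notin> S" using w1 noout[of w1] unfolding Out_def X_def by blast
  have In_hd: "w = w1" if w: "w \<in> A - C" "E w x" "z' \<in> C" "E z' w" for w z'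
  proof (rule ccontr)
    assume ne: "w \<noteq> w1"
    obtain z'' where z'': "z'' \<in> C" "E w1 z''" using w1 unfolding Out_def by blast
    have "w \<noteq> x" using w irrefl by blast
    moreover have "x \<noteq> w1" using w1S xS by blast
    ultimately have "bypass A S C z' [w, x, w1] z''" unfolding bypass_def
      using w w1 ne xS z'' unfolding Out_def by auto
    then show False using NB z'' w by blast
  qed
  have xy: "x \<noteq> y" "y \<in> A" using xS y C by auto
  \<comment> \<open>Vertices of \<open>C\<close> are not adjacent to \<open>x\<close>, targets
    outside \<open>C\<close> not to \<open>y\<close>. Any other vertex but \<open>w1\<close> carries
    at most one arc of each two-step path between \<open>x\<close> and \<open>y\<close>. The total
    stays at most \<open>2 * card A - 2\<close>.\<close>
  have pw: "present x w + present y w \<le> 2 + (if w = w1 then 2 else 0)" if w: "w \<in> A - {x, y}" for w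
  proof -
    consider "w \<in> C" | "w \<in> X" | "w \<in> A - C" "w \<notin> S" using w X_def by blast
    then show ?thesis
    proof cases
      case 1
      then have "present x w = 0" using noin[OF xX 1] noout[OF xX 1] by (simp add: present_eq_0_iff)
      then show ?thesis using present_le_2[of y w] by simp
    next
      case 2
      then have "present y w = 0" using noin[OF 2 y(2)] noout[OF 2 y(2)] by (simp add: present_eq_0_iff)
      then show ?thesis using present_le_2[of x w] by simp
    next
      case 3
      show ?thesis
      proof (cases "w = w1")
        case True
        then show ?thesis using present_le_2[of x w] present_le_2[of y w] by simp
      next
        case False
        have "\<not> (E w x \<and> E y w)" using In_hd[OF 3(1) _ y(2)] False by blast
        moreover have "\<not> (E x w \<and> E w y)" using Out_hd[of w] 3 y False unfolding Out_def w1_def by blast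
        ultimately show ?thesis by (auto simp: present_def)
      qed
    qed
  qed
  have cA: "card (A - {x, y}) + 2 = card A" "card A \<ge> 2"
    using fin xy xS card_Diff_subset[of "{x,y}" A] card_mono[of A "{x,y}"] by auto
  have "(\<Sum>w\<in>A - {x, y}. present x w + present y w) \<le> (\<Sum>w\<in>A - {x, y}. 2 + (if w = w1 then 2 else 0))"
    by (intro sum_mono pw)
  also have "\<dots> \<le> 2 * card (A - {x, y}) + 2"
    unfolding sum.distrib using fin by simp
  finally have "(\<Sum>w\<in>A - {x, y}. present x w + present y w) \<le> 2 * card (A - {x, y}) + 2" .
  moreover have "present x y = 0" using noin[OF xX y(2)] noout[OF xX y(2)] by (simp add: present_eq_0_iff)
  moreover have "2 * card A \<le> (\<Sum>w\<in>A - {x, y}. present x w + present y w) + 2 * present x y"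
    using present_pair_sum[OF fin xS(3) xy(2,1) deg[OF xS(1)] deg[OF y(1)]] .
  ultimately show False using cA by linarith
qed

text \<open>A cycle with the most targets is rerouted along a bypass skipping as few of its vertices
  as possible. Some skipped target \<open>y\<close> cannot be put back, and \<open>y\<close>
  together with a new target \<open>x\<close> on the bypass violates
  \<open>present_pair_sum\<close>.\<close>

lemma cyclable:
  assumes fin: "finite A" and SA: "S \<subseteq> A" and "S \<noteq> {}"
    and indep: "\<And>u v. u \<in> A \<Longrightarrow> v \<in> A \<Longrightarrow> E u v \<Longrightarrow> u \<in> S \<or> v \<in> S"
    and deg: "\<And>x. x \<in> S \<Longrightarrow> missing_deg x A + 2 \<le> card A"
    and strong: "\<And>x y. x \<in> S \<Longrightarrow> y \<in> S \<Longrightarrow> (x, y) \<in> (induced_rel E A)\<^sup>*"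
  shows "\<exists>zs. cycle_list zs \<and> S \<subseteq> set zs \<and> set zs \<subseteq> A"
proof (rule ccontr)
  assume none: "\<not> ?thesis"
  have finS: "finite S" using fin SA finite_subset by blast
  define ok where "ok zs \<longleftrightarrow> cycle_list zs \<and> set zs \<subseteq> A" for zs
  obtain s where s: "s \<in> S" using \<open>S \<noteq> {}\<close> by blast
  obtain v where v: "v \<in> A" "v \<noteq> s" "missing s v = 0" using digon_exists[OF fin _ deg[OF s]] s SA by blast
  have ok1: "ok [s, v]" using v s SA cycle_list_pair[of s v] unfolding ok_def by auto
  have "\<exists>zs. ok zs \<and> (\<forall>zs'. ok zs' \<longrightarrow> card (S \<inter> set zs') \<le> card (S \<inter> set zs))"
    using ok1 finS by (intro ex_has_greatest_nat[of ok _ _ "Suc (card S)"]) 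
      (auto simp: less_Suc_eq_le intro: card_mono)
  then obtain zs0 where zs0: "ok zs0" "\<And>zs'. ok zs' \<Longrightarrow> card (S \<inter> set zs') \<le> card (S \<inter> set zs0)" by blast
  define best where "best zs \<longleftrightarrow> ok zs \<and> card (S \<inter> set zs) = card (S \<inter> set zs0)" for zs
  have better: False if "best zs" "ok zs'" "x \<in> S" "x \<in> set zs'" "x \<notin> set zs" "S \<inter> set zs \<subseteq> set zs'" for zs zs' x
  proof -
    have "card (insert x (S \<inter> set zs)) \<le> card (S \<inter> set zs')"
      using that finS by (intro card_mono) auto
    then show False using that finS zs0(2)[OF that(2)] unfolding best_def by simp
  qed
  \<comment> \<open>The value \<open>r = length zs\<close> stands for a closed bypass, which returns to its starting point.\<close>
  define BP where "BP zs r ps \<longleftrightarrow> best zs \<and> 1 \<le> r \<and> r \<le> length zs \<and>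
     bypass A S (set zs) (hd zs) ps (zs ! (r mod length zs))" for zs r ps
  have "\<exists>r zs ps. BP zs r ps"
  proof -
    have "card (S \<inter> set [s, v]) \<le> card (S \<inter> set zs0)" using zs0(2)[OF ok1] .
    moreover have "card (S \<inter> set [s, v]) > 0" using s finS by (subst card_gt_0_iff) auto
    ultimately have "S \<inter> set zs0 \<noteq> {}" by (metis card.empty not_le)
    moreover have "set zs0 \<subseteq> A" "\<not> S \<subseteq> set zs0" using zs0(1) none unfolding ok_def by blast+
    ultimately obtain z z' ps where z: "z \<in> set zs0" "z' \<in> set zs0" "bypass A S (set zs0) z ps z'"
      using bypass_exists[OF fin SA indep deg strong, of "set zs0"] by blast
    obtain zs where zs: "cycle_list zs" "set zs = set zs0" "hd zs = z" "length zs = length zs0"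
      using cycle_list_obtain_hd[OF _ z(1)] zs0(1) unfolding ok_def by blast
    obtain i where i: "i < length zs" "zs ! i = z'" using z(2) zs(2) by (metis in_set_conv_nth)
    define r where "r = (if i = 0 then length zs else i)"
    have "BP zs r ps" unfolding BP_def best_def ok_def
      using zs z i zs0(1) unfolding ok_def by (auto simp: r_def)
    then show ?thesis by blast
  qed
  then have ex: "\<exists>r. \<exists>zs ps. BP zs r ps" by blast
  \<comment> \<open>The skipped segment is minimized first, over all best cycles and their
    rotations, and only then the length of the bypass.\<close>
  define r where "r = (LEAST r. \<exists>zs ps. BP zs r ps)"
  have minr: "r \<le> r'" if "BP zs' r' ps'" for zs' r' ps'
    unfolding r_def using that by (intro Least_le) blast
  have "\<exists>l zs ps. BP zs r ps \<and> length ps = l" using LeastI_ex[OF ex] unfolding r_def by blast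
  then have exl: "\<exists>l. \<exists>zs ps. BP zs r ps \<and> length ps = l" by blast
  define l where "l = (LEAST l. \<exists>zs ps. BP zs r ps \<and> length ps = l)"
  obtain zs ps where BP: "BP zs r ps" and l: "length ps = l"
    using LeastI_ex[OF exl] unfolding l_def by blast
  have minl: "length ps \<le> length ps'" if "BP zs' r ps'" for zs' ps'
    unfolding l l_def using that by (intro Least_le) blast
  define c where "c = length zs"
  define z0 where "z0 = hd zs"
  define zr where "zr = zs ! (r mod c)"
  have best: "best zs" and r: "1 \<le> r" "r \<le> c" and bp: "bypass A S (set zs) z0 ps zr"
    using BP unfolding BP_def c_def z0_def zr_def by auto
  have czs: "cycle_list zs" "set zs \<subseteq> A" "zs \<noteq> []" "distinct zs"
    using best unfolding best_def ok_def cycle_list_def by auto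
  have ps: "ps \<noteq> []" "distinct ps" "successively E ps" "set ps \<subseteq> A - set zs" "E z0 (hd ps)" "E (last ps) zr"
    and "S \<inter> set ps \<noteq> {}" using bp unfolding bypass_def by auto
  then obtain x where x: "x \<in> S" "x \<in> set ps" by blast
  then obtain as bs where ab: "ps = as @ x # bs" by (meson split_list)
  have xA: "x \<in> A" "x \<notin> set zs" using x ps by auto

  \<comment> \<open>\<open>gap\<close> holds the vertices strictly between the ends of the bypass,
    and \<open>Q0\<close> runs from \<open>zr\<close> around to \<open>z0\<close>. For a closed
    bypass, \<open>r = c\<close> and \<open>Q0\<close> is just \<open>[z0]\<close>.\<close>
  define gap where "gap = take (r - 1) (tl zs)"
  define Q0 where "Q0 = drop r zs @ [z0]"
  have zs_eq: "zs = z0 # gap @ drop r zs"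
  proof -
    have "tl zs = gap @ drop (r - 1) (tl zs)" unfolding gap_def by simp
    also have "drop (r - 1) (tl zs) = drop r zs" using r by (metis Suc_diff_1 drop_Suc less_eq_Suc_le One_nat_def)
    finally show ?thesis using czs(3) unfolding z0_def by (cases zs) auto
  qed
  have cycgap: "cycle_list (gap @ Q0)"
    using cycI_append[of "[z0]" "gap @ drop r zs"] czs(1) zs_eq unfolding Q0_def by simp
  have set_gap: "set zs = set gap \<union> set Q0" "set gap \<inter> set Q0 = {}"
    using zs_eq czs(4) unfolding Q0_def by (metis Un_insert_right list.simps(15) set_append Un_commute append_Nil2 set_empty2 empty_set sup_bot.right_neutral,
        metis cycgap Q0_def cycle_list_def distinct_append)
  have Q0: "Q0 \<noteq> []" "distinct Q0" "successively E Q0" "last Q0 = z0"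
    using cycgap unfolding cycle_list_def Q0_def by (auto simp: successively_append_iff)
  have hdQ0: "hd Q0 = zr"
    using r czs(3) by (cases "r = c") (auto simp: Q0_def zr_def c_def z0_def hd_drop_conv_nth hd_append hd_conv_nth)
  have lenQ0: "length Q0 + r = c + 1" using r unfolding Q0_def c_def by auto
  have gap_nth: "\<exists>i. 1 \<le> i \<and> i < r \<and> y = zs ! i" if y: "y \<in> set gap" for y
  proof -
    have "length gap = r - 1" using r unfolding gap_def c_def by auto
    then obtain j where j: "j < r - 1" "y = gap ! j" using y by (metis in_set_conv_nth)
    have "y = zs ! Suc j" using j \<open>length gap = r - 1\<close> by (subst zs_eq) (simp add: nth_append)
    then show ?thesis using j by (intro exI[of _ "Suc j"]) auto
  qed
  \<comment> \<open>\<open>F1\<close> and \<open>F2\<close> express minimality of \<open>r\<close>: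
    a bypass from \<open>z0\<close> into the gap, or from the gap to \<open>zr\<close>, skips fewer
    vertices. In \<open>F2\<close> the cycle is rotated to start at \<open>y\<close>.
    \<open>F3\<close> expresses minimality of the bypass length.\<close>
  have F1: False if y: "y \<in> set gap" and b: "bypass A S (set zs) z0 ps' y" for y ps'
  proof -
    obtain i where i: "1 \<le> i" "i < r" "y = zs ! i" using gap_nth[OF y] by blast
    have "BP zs i ps'" unfolding BP_def using best i r b unfolding c_def z0_def by auto
    then show False using minr i by fastforce
  qed
  have F2: False if y: "y \<in> set gap" and b: "bypass A S (set zs) y ps' zr" for y ps'
  proof -
    obtain i where i: "1 \<le> i" "i < r" "y = zs ! i" using gap_nth[OF y] by blast
    have "best (rotate i zs)" using best cycle_list_rotate unfolding best_def ok_def by auto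
    moreover have "hd (rotate i zs) = y" using i r czs(3) by (simp add: hd_rotate_conv_nth c_def)
    moreover have "rotate i zs ! ((r - i) mod c) = zr"
    proof -
      have "rotate i zs ! ((r - i) mod c) = zs ! ((i + (r - i) mod c) mod c)"
        using r i by (simp add: nth_rotate c_def)
      also have "(i + (r - i) mod c) mod c = r mod c"
        using i by (metis less_imp_le mod_add_right_eq le_add_diff_inverse)
      finally show ?thesis unfolding zr_def .
    qed
    ultimately have "BP (rotate i zs) (r - i) ps'" unfolding BP_def using i r b unfolding c_def by auto
    then show False using minr[of _ "r - i"] i by fastforce
  qed
  have F3: "length ps \<le> length ps'" if "bypass A S (set zs) z0 ps' zr" for ps'
    using minl[of zs ps'] best that r unfolding BP_def c_def z0_def zr_def by auto

  have bpI: "bypass A S (set zs) a ps' b" if "ps' \<noteq> []" "distinct ps'" "successively E ps'" "set ps' \<subseteq> A - set zs"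
    "E a (hd ps')" "E (last ps') b" "x \<in> set ps'" for a ps' b
    using that x unfolding bypass_def by blast
  have psD: "distinct as" "distinct bs" "set as \<inter> set bs = {}" "x \<notin> set as" "x \<notin> set bs"
    "successively E as" "successively E bs" "as \<noteq> [] \<Longrightarrow> E (last as) x" "bs \<noteq> [] \<Longrightarrow> E x (hd bs)"
    "set as \<subseteq> A - set zs" "set bs \<subseteq> A - set zs" "as \<noteq> [] \<Longrightarrow> E z0 (hd as)" "bs \<noteq> [] \<Longrightarrow> E (last bs) zr"
    "as = [] \<Longrightarrow> E z0 x" "bs = [] \<Longrightarrow> E x zr"
    using ps unfolding ab by (auto simp: successively_append_iff successively_Cons)
  \<comment> \<open>The piece of the bypass up to \<open>x\<close> followed by an arc to
    \<open>y\<close>, or an arc from \<open>y\<close> followed by the piece from \<open>x\<close>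
    on, would contradict \<open>F1\<close> or \<open>F2\<close>.\<close>
  have xgap: "\<not> E x y" "\<not> E y x" if y: "y \<in> set gap" for y
  proof -
    show "\<not> E x y"
      using F1[OF y bpI, of "as @ [x]"] psD xA by (cases "as = []") (auto simp: successively_append_iff)
    show "\<not> E y x"
      using F2[OF y bpI, of "x # bs"] psD xA by (cases "bs = []") (auto simp: successively_Cons)
  qed
  have z0x: "as = []" if "E z0 x"
    using F3[OF bpI, of "x # bs"] psD xA that ab by (cases "bs = []") (auto simp: successively_Cons)
  have xzr: "bs = []" if "E x zr"
    using F3[OF bpI, of "as @ [x]"] psD xA that ab by (cases "as = []") (auto simp: successively_append_iff)

  \<comment> \<open>Insert as many vertices of the gap as possible into the remaining arc of the cycle; a target
    that cannot be inserted has, together with \<open>x\<close>, too few arcs.\<close>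
  define path where "path Q \<longleftrightarrow> Q \<noteq> [] \<and> distinct Q \<and> successively E Q \<and> set Q0 \<subseteq> set Q \<and> set Q \<subseteq> set zs \<and>
     hd Q = zr \<and> last Q = z0" for Q
  have "path Q0" unfolding path_def using Q0 hdQ0 set_gap by blast
  then have "\<exists>Q. path Q \<and> (\<forall>Q'. path Q' \<longrightarrow> length Q' \<le> length Q)"
    by (intro ex_has_greatest_nat[of path _ _ "Suc c"])
       (auto simp: path_def c_def less_Suc_eq_le, metis card_mono distinct_card card_length le_trans List.finite_set)
  then obtain Q where Q: "path Q" and Qmax: "\<And>Q'. path Q' \<Longrightarrow> length Q' \<le> length Q" by blast
  have QD: "Q \<noteq> []" "distinct Q" "successively E Q" "set Q0 \<subseteq> set Q" "set Q \<subseteq> set zs" "hd Q = zr" "last Q = z0"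
    using Q unfolding path_def by auto
  have cQ: "card (set Q) = length Q" "card (set Q0) = length Q0" "card (set zs) = c"
    using QD Q0 czs distinct_card c_def by auto
  have "ok (ps @ Q)" unfolding ok_def cycle_list_def
    using ps QD czs(2) by (auto simp: successively_append_iff)
  \<comment> \<open>Closing \<open>Q\<close> by the bypass gives a cycle through the new target
    \<open>x\<close>; by the choice of \<open>zs\<close> it must lose an old target.\<close>
  then have "\<not> S \<inter> set zs \<subseteq> set Q"
    using better[OF best, of "ps @ Q" x] x xA by auto
  then obtain y where y: "y \<in> S" "y \<in> set zs" "y \<notin> set Q" by blast
  have ygap: "y \<in> set gap" using y QD set_gap by blast
  have yA: "y \<in> A" "x \<noteq> y" using y czs xA by auto

  have yQ: "(\<Sum>w\<in>set Q. present y w) \<le> length Q + 1"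
  proof -
    have "(\<Sum>q\<in>set Q. present y q) + 1 \<le> length Q + of_bool (E y (hd Q)) + of_bool (E (last Q) y)"
    proof (intro noninsertable_path[OF QD(1,2)] notI)
      fix a b assume h: "Q = a @ b" "a \<noteq> []" "b \<noteq> []" "E (last a) y \<and> E y (hd b)"
      have "path (a @ y # b)" using QD h y unfolding path_def
        by (auto simp: successively_append_iff successively_Cons)
      then show False using Qmax[of "a @ y # b"] h by simp
    qed
    moreover have "of_bool (E y (hd Q)) \<le> (1::nat)" "of_bool (E (last Q) y) \<le> (1::nat)" by auto
    ultimately show ?thesis by linarith
  qed
  \<comment> \<open>Inserting \<open>x\<close> into \<open>Q0\<close> would enlarge the original
    cycle with its gap intact. The end terms occur only if \<open>x\<close> is last or first on the
    bypass, since otherwise the bypass could be shortened.\<close>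
  have xQ0: "(\<Sum>w\<in>set Q0. present x w) + 1 \<le> length Q0 + of_bool (bs = []) + of_bool (as = [])"
  proof -
    have "(\<Sum>q\<in>set Q0. present x q) + 1 \<le> length Q0 + of_bool (E x (hd Q0)) + of_bool (E (last Q0) x)"
    proof (intro noninsertable_path[OF Q0(1,2)] notI)
      fix a b assume h: "Q0 = a @ b" "a \<noteq> []" "b \<noteq> []" "E (last a) x \<and> E x (hd b)"
      have sub: "set a \<union> set b \<subseteq> set zs" "set gap \<subseteq> set zs" using h set_gap by auto
      have "cycle_list ((gap @ a) @ x # b)"
        using cycgap h xA sub by (intro cycle_list_insert) auto
      then have "ok ((gap @ a) @ x # b)" unfolding ok_def using xA czs(2) sub by auto
      then show False using better[OF best, of "(gap @ a) @ x # b" x] x(1) xA(2) set_gap(1) h(1) by auto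
    qed
    moreover have "of_bool (E x (hd Q0)) \<le> (of_bool (bs = []) :: nat)"
      "of_bool (E (last Q0) x) \<le> (of_bool (as = []) :: nat)"
      using z0x xzr hdQ0 Q0(4) by auto
    ultimately show ?thesis by linarith
  qed
  have xQ: "(\<Sum>w\<in>set Q. present x w) = (\<Sum>w\<in>set Q0. present x w)"
    using QD set_gap xgap by (intro sum.mono_neutral_right) (auto simp: present_eq_0_iff)
  define R where "R = set zs - set Q - {y}"
  have R: "(\<Sum>w\<in>R. present x w + present y w) \<le> 2 * card R"
  proof -
    have "(\<Sum>w\<in>R. present x w + present y w) \<le> (\<Sum>w\<in>R. 2)"
    proof (intro sum_mono)
      fix w assume "w \<in> R"
      then have "w \<in> set gap" using set_gap QD unfolding R_def by auto
      then have "present x w = 0" using xgap by (simp add: present_eq_0_iff)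
      then show "present x w + present y w \<le> 2" using present_le_2 by simp
    qed
    then show ?thesis by simp
  qed
  have cR: "card R + length Q + 1 = c"
  proof -
    have "card (set zs - set Q) = c - length Q" using QD cQ by (simp add: card_Diff_subset)
    moreover have "card R = card (set zs - set Q) - 1" unfolding R_def using y by simp
    moreover have "card (set zs - set Q) > 0" using y by (subst card_gt_0_iff) auto
    ultimately show ?thesis by linarith
  qed
  define H where "H = A - set zs"
  \<comment> \<open>Off the bypass, a two-step path between \<open>x\<close> and \<open>y\<close>
    would end inside the gap or start there. On it, arcs between \<open>w\<close> and
    \<open>y\<close> in one direction shorten the gap and arcs between \<open>w\<close> and
    \<open>x\<close> shorten the bypass, unless \<open>w\<close> is the neighbour of
    \<open>x\<close> on it.\<close>
  have Hbound: "present x w + present y w \<le> 2 + (if as \<noteq> [] \<and> w = last as then 1 else 0)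
        + (if bs \<noteq> [] \<and> w = hd bs then 1 else 0)" if w: "w \<in> H - {x}" for w
  proof -
    have wA: "w \<in> A - set zs" "w \<noteq> x" using w unfolding H_def by auto
    consider "w \<notin> set ps" | "w \<in> set as" | "w \<in> set bs" using wA ab by auto
    then show ?thesis
    proof cases
      case 1
      then have "w \<notin> set as" "w \<notin> set bs" using ab by auto
      then have "\<not> (E x w \<and> E w y)"
        using F1[OF ygap bpI, of "as @ [x, w]"] psD xA wA by (cases "as = []") (auto simp: successively_append_iff successively_Cons)
      moreover have "\<not> (E y w \<and> E w x)"
        using F2[OF ygap bpI, of "w # x # bs"] psD xA wA \<open>w \<notin> set bs\<close>
        by (cases "bs = []") (auto simp: successively_Cons)
      ultimately show ?thesis by (auto simp: present_def)
    next
      case 2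
      then obtain a1 a2 where a: "as = a1 @ w # a2" by (meson split_list)
      have psw: "distinct (a1 @ w # a2)" "successively E (a1 @ w # a2)" "set (a1 @ w # a2) \<subseteq> A - set zs"
        using psD a by auto
      have nyw: "\<not> E y w"
        using F2[OF ygap bpI, of "w # a2 @ x # bs"] psD xA wA unfolding a
        by (cases "bs = []"; cases "a2 = []") (auto simp: successively_append_iff successively_Cons)
      have nwx: "\<not> E w x" if "a2 \<noteq> []"
        using F3[OF bpI, of "a1 @ w # x # bs"] psD xA wA that unfolding ab a
        by (cases "bs = []"; cases "a1 = []") (auto simp: successively_append_iff successively_Cons)
      show ?thesis
      proof (cases "a2 = []")
        case True
        then show ?thesis using nyw a present_le_2[of x w] by (auto simp: present_def[of y w])
      next
        case False
        then show ?thesis using nyw nwx by (auto simp: present_def)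
      qed
    next
      case 3
      then obtain b1 b2 where b: "bs = b1 @ w # b2" by (meson split_list)
      have nyw: "\<not> E w y"
        using F1[OF ygap bpI, of "as @ x # b1 @ [w]"] psD xA wA unfolding b
        by (cases "as = []"; cases "b1 = []") (auto simp: successively_append_iff successively_Cons)
      have nwx: "\<not> E x w" if "b1 \<noteq> []"
        using F3[OF bpI, of "as @ x # w # b2"] psD xA wA that unfolding ab b
        by (cases "as = []"; cases "b2 = []") (auto simp: successively_append_iff successively_Cons)
      show ?thesis
      proof (cases "b1 = []")
        case True
        then show ?thesis using nyw b present_le_2[of x w] by (auto simp: present_def[of y w])
      next
        case False
        then show ?thesis using nyw nwx by (auto simp: present_def)
      qed
    qed
  qed
  have finH: "finite (H - {x})" using fin unfolding H_def by simp
  have Hsum: "(\<Sum>w\<in>H - {x}. present x w + present y w) \<le> 2 * card (H - {x}) + of_bool (as \<noteq> []) + of_bool (bs \<noteq> [])"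
  proof -
    have d1: "(\<Sum>w\<in>H - {x}. if P \<and> w = a then 1 else 0) \<le> (of_bool P :: nat)" for P a
      using finH by (cases P) auto
    have "(\<Sum>w\<in>H - {x}. present x w + present y w) \<le>
       (\<Sum>w\<in>H - {x}. 2 + (if as \<noteq> [] \<and> w = last as then 1 else 0) + (if bs \<noteq> [] \<and> w = hd bs then 1 else 0))"
      by (intro sum_mono Hbound)
    also have "\<dots> \<le> 2 * card (H - {x}) + of_bool (as \<noteq> []) + of_bool (bs \<noteq> [])"
      unfolding sum.distrib using d1[of "as \<noteq> []" "last as"] d1[of "bs \<noteq> []" "hd bs"] by (intro add_mono) auto
    finally show ?thesis .
  qed
  have cH: "card (H - {x}) + 1 + c = card A"
  proof -
    have "card H + c = card A" unfolding H_def using fin czs(2) cQ card_mono[OF fin czs(2)] 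
      by (simp add: card_Diff_subset)
    moreover have "Suc (card (H - {x})) = card H"
      by (intro card_Suc_Diff1) (use xA fin in \<open>auto simp: H_def\<close>)
    ultimately show ?thesis by linarith
  qed
  have split: "A - {x, y} = (H - {x}) \<union> (set Q \<union> R)" "(H - {x}) \<inter> (set Q \<union> R) = {}" "set Q \<inter> R = {}"
    using y QD xA czs(2) unfolding H_def R_def by auto
  have "(\<Sum>w\<in>A - {x, y}. present x w + present y w) =
     (\<Sum>w\<in>H - {x}. present x w + present y w) + ((\<Sum>w\<in>set Q. present x w + present y w) + (\<Sum>w\<in>R. present x w + present y w))"
    unfolding split(1) using split(2,3) finH R_def by (subst sum.union_disjoint; simp add: sum.union_disjoint)
  moreover have "2 * card A \<le> (\<Sum>w\<in>A - {x, y}. present x w + present y w) + 2 * present x y"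
    using present_pair_sum[OF fin xA(1) yA deg[OF x(1)] deg[OF y(1)]] .
  moreover have "present x y = 0" using xgap[OF ygap] by (simp add: present_eq_0_iff)
  moreover have "length Q0 \<le> length Q" using QD(4) cQ card_mono[of "set Q" "set Q0"] by simp
  \<comment> \<open>Each neighbour of \<open>x\<close> on the bypass costs one extra arc outside the
    cycle, but its existence excludes one end term in \<open>xQ0\<close>. The total is therefore at
    most \<open>2 * (card A - 2) + 2\<close>, which is less than \<open>2 * card A\<close>.\<close>
  moreover have "of_bool (as \<noteq> []) + of_bool (as = []) = (1::nat)" "of_bool (bs \<noteq> []) + of_bool (bs = []) = (1::nat)"
    by auto
  ultimately show False using Hsum R xQ xQ0 yQ cH cR unfolding sum.distrib by linarith
qed

section \<open>Cycles with a prescribed number of targets\<close>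

lemma sum_nth_shift:
  assumes "distinct zs"
  shows "(\<Sum>i<length zs. f (zs ! ((i + d) mod length zs))) = (\<Sum>z\<in>set zs. f z)"
proof -
  have "(\<Sum>i<length zs. f (zs ! ((i + d) mod length zs))) = (\<Sum>i<length zs. f (rotate d zs ! i))"
    by (intro sum.cong refl) (simp add: nth_rotate add.commute)
  also have "\<dots> = sum_list (map f (rotate d zs))"
    by (simp add: sum_list_sum_nth atLeast0LessThan)
  also have "\<dots> = (\<Sum>z\<in>set zs. f z)"
    using assms by (simp add: sum_list_distinct_conv_sum_set)
  finally show ?thesis .
qed

text \<open>Pairing the arc from position \<open>i\<close> with the arc to position
  \<open>i + d\<close> tests whether \<open>x\<close> can replace the \<open>d - 1\<close> vertices
  between them. The values 1, 2 and 3 of \<open>d\<close> serve for insertion, for replacing one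
  vertex and for replacing two.\<close>

lemma missing_deg_nth:
  assumes "distinct zs" "x \<notin> set zs"
  shows "missing_deg x (set zs) =
    (\<Sum>i<length zs. of_bool (\<not> E (zs ! i) x) + of_bool (\<not> E x (zs ! ((i + d) mod length zs))))"
proof -
  have "(\<Sum>i<length zs. of_bool (\<not> E (zs ! i) x) :: nat) = (\<Sum>i<length zs. of_bool (\<not> E (zs ! ((i + 0) mod length zs)) x))"
    by (intro sum.cong refl) auto
  also have "\<dots> = (\<Sum>z\<in>set zs. of_bool (\<not> E z x) :: nat)"
    using sum_nth_shift[OF assms(1), of "\<lambda>z. of_bool (\<not> E z x) :: nat" 0] .
  finally have "(\<Sum>i<length zs. of_bool (\<not> E (zs ! i) x) + of_bool (\<not> E x (zs ! ((i + d) mod length zs)))) =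
    (\<Sum>z\<in>set zs. of_bool (\<not> E z x)) + (\<Sum>z\<in>set zs. of_bool (\<not> E x z) :: nat)"
    unfolding sum.distrib
    using sum_nth_shift[OF assms(1), of "\<lambda>z. of_bool (\<not> E x z) :: nat" d] by argo
  moreover have "missing_deg x (set zs) = (\<Sum>z\<in>set zs. of_bool (\<not> E z x)) + (\<Sum>z\<in>set zs. of_bool (\<not> E x z) :: nat)"
  proof -
    have "set zs - {x} = set zs" using assms(2) by simp
    then show ?thesis unfolding missing_deg_def missing_def sum.distrib by (simp only: add.commute)
  qed
  ultimately show ?thesis by argo
qed

lemma missing_deg_not_in: "x \<notin> A \<Longrightarrow> missing_deg x A = (\<Sum>y\<in>A. missing x y)"
  by (simp add: missing_deg_def)

lemma missing_deg_Un:
  assumes "finite A" "finite B" "A \<inter> B = {}"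
  shows "missing_deg x (A \<union> B) = missing_deg x A + missing_deg x B"
proof -
  have "A \<union> B - {x} = (A - {x}) \<union> (B - {x})" by blast
  then show ?thesis unfolding missing_deg_def by (simp, intro sum.union_disjoint) (use assms in auto)
qed

lemma missing_deg_Diff:
  assumes "finite A" "B \<subseteq> A"
  shows "missing_deg x A = missing_deg x (A - B) + missing_deg x B"
proof -
  have "A = (A - B) \<union> B" using assms(2) by blast
  then show ?thesis using missing_deg_Un[of "A - B" B x] assms finite_subset[OF assms(2,1)] by auto
qed

lemma missing_deg_mono: "finite B \<Longrightarrow> A \<subseteq> B \<Longrightarrow> missing_deg x A \<le> missing_deg x B"
  using missing_deg_Diff[of B A x] by simp

lemma missing_deg_ge_card:
  assumes "finite A" "x \<notin> A" "\<And>y. y \<in> A \<Longrightarrow> missing x y \<ge> 1"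
  shows "card A \<le> missing_deg x A"
proof -
  have "(\<Sum>y\<in>A. 1) \<le> missing_deg x A"
    unfolding missing_deg_not_in[OF assms(2)] by (intro sum_mono assms)
  then show ?thesis by simp
qed

text \<open>After rotation by \<open>i + 1\<close> the vertex at position \<open>i\<close> comes
  last and the \<open>m\<close> vertices to be removed come first, so \<open>x\<close> closes the
  rest into a cycle.\<close>

lemma cycle_list_replace:
  assumes zs: "cycle_list zs" "x \<notin> set zs" and i: "i < length zs" "m < length zs"
    and E: "E (zs ! i) x" "E x (zs ! ((i + 1 + m) mod length zs))"
  shows "cycle_list (x # drop m (rotate (i + 1) zs))"
proof -
  let ?r = "rotate (i + 1) zs"
  have ne: "zs \<noteq> []" "drop m ?r \<noteq> []" using i by auto
  have "cycle_list ?r" using cycle_list_rotate zs(1) by blast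
  then have "distinct (drop m ?r)" "successively E (drop m ?r)"
    unfolding cycle_list_def by (auto simp: distinct_drop)
      (metis append_take_drop_id successively_append_iff)
  moreover have "last (drop m ?r) = zs ! i"
  proof -
    have "last (drop m ?r) = ?r ! (length zs - 1)" using i by (simp add: last_conv_nth)
    also have "\<dots> = zs ! ((i + 1 + (length zs - 1)) mod length zs)" using i by (subst nth_rotate) auto
    also have "(i + 1 + (length zs - 1)) mod length zs = i"
    proof -
      have "i + 1 + (length zs - 1) = i + length zs" using i by simp
      then show ?thesis using i by simp
    qed
    finally show ?thesis .
  qed
  moreover have "hd (drop m ?r) = zs ! ((i + 1 + m) mod length zs)"
    using i by (simp add: hd_drop_conv_nth nth_rotate del: rotate_Suc)
  moreover have "x \<notin> set (drop m ?r)" using zs(2) by (metis in_set_dropD set_rotate)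
  ultimately show ?thesis unfolding cycle_list_def using ne E by (auto simp: successively_Cons)
qed

lemma set_drop_rotate:
  assumes "distinct zs" "m \<le> length zs"
  shows "set (drop m (rotate j zs)) = set zs - (\<lambda>l. zs ! ((j + l) mod length zs)) ` {..<m}"
proof -
  have "set (drop m (rotate j zs)) = set (rotate j zs) - set (take m (rotate j zs))"
    using assms set_take_disj_set_drop_if_distinct[of "rotate j zs" m m]
    by (metis Diff_cancel Un_Diff append_take_drop_id distinct_rotate Diff_triv Int_commute le_refl set_append sup_bot_left)
  also have "set (take m (rotate j zs)) = (\<lambda>l. zs ! ((j + l) mod length zs)) ` {..<m}"
    using assms by (auto simp: nth_image[symmetric] nth_rotate image_iff lessThan_atLeast0)
  finally show ?thesis by simp
qed

text \<open>With shift 1, every position where \<open>x\<close> does not fit accounts for a missing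
  arc of its own.\<close>

lemma insertable:
  assumes zs: "cycle_list zs" "x \<notin> set zs" and "missing_deg x (set zs) < length zs"
  shows "\<exists>zs'. cycle_list zs' \<and> set zs' = insert x (set zs) \<and> length zs' = Suc (length zs)"
proof -
  have d: "distinct zs" using zs unfolding cycle_list_def by blast
  have "\<exists>i<length zs. E (zs ! i) x \<and> E x (zs ! ((i + 1) mod length zs))"
  proof (rule ccontr)
    assume "\<not> ?thesis"
    then have "(\<Sum>i<length zs. 1) \<le> missing_deg x (set zs)"
      unfolding missing_deg_nth[OF d zs(2), of 1] by (intro sum_mono) auto
    then show False using assms(3) by simp
  qed
  then obtain i where i: "i < length zs" "E (zs ! i) x" "E x (zs ! ((i + 1) mod length zs))" by blast
  then have "cycle_list (x # rotate (i + 1) zs)"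
    using cycle_list_replace[OF zs i(1), of 0] zs(1) by (simp add: cycle_list_def)
  then show ?thesis by (intro exI[of _ "x # rotate (i + 1) zs"]) auto
qed

text \<open>
  If a cycle cannot be extended, every other vertex misses at least as many arcs to it as it has
  vertices; so deleting the cycle preserves the hypothesis.
\<close>

lemma cycle_of_length:
  assumes "finite W" "\<And>x. x \<in> W \<Longrightarrow> missing_deg x W \<le> k" "k + j \<le> card W" "2 \<le> j"
  shows "\<exists>zs. cycle_list zs \<and> set zs \<subseteq> W \<and> length zs = j"
  using assms
proof (induction "card W" arbitrary: W k rule: less_induct)
  case (less W k)
  have "W \<noteq> {}" using less.prems by auto
  then obtain x where x: "x \<in> W" by blast
  have "missing_deg x W + 2 \<le> card W" using less.prems(2)[OF x] less.prems(3,4) by linarith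
  then obtain v where v: "v \<in> W" "v \<noteq> x" "missing x v = 0" using digon_exists[OF less.prems(1) x] by blast
  define ok where "ok zs \<longleftrightarrow> cycle_list zs \<and> set zs \<subseteq> W \<and> length zs \<le> j" for zs
  have "ok [x, v]" using v x less.prems(4) cycle_list_pair[of x v] unfolding ok_def by auto
  then have "\<exists>zs. ok zs \<and> (\<forall>zs'. ok zs' \<longrightarrow> length zs' \<le> length zs)"
    by (intro ex_has_greatest_nat[of ok _ _ "Suc j"]) (auto simp: ok_def)
  then obtain zs where zs: "ok zs" and max: "\<And>zs'. ok zs' \<Longrightarrow> length zs' \<le> length zs" by blast
  show ?case
  proof (cases "length zs = j")
    case True
    then show ?thesis using zs unfolding ok_def by blast
  next
    case False
    let ?l = "length zs"
    have l: "?l < j" "cycle_list zs" "set zs \<subseteq> W" "distinct zs" "0 < ?l" using zs False unfolding ok_def cycle_list_def by auto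
    have stuck: "?l \<le> missing_deg x (set zs)" if x: "x \<in> W - set zs" for x
    proof (rule ccontr)
      assume "\<not> ?thesis"
      then obtain zs' where "cycle_list zs'" "set zs' = insert x (set zs)" "length zs' = Suc ?l"
        using insertable[OF l(2), of x] x by auto
      then have "ok zs'" using l x unfolding ok_def by auto
      from max[OF this] show False using \<open>length zs' = Suc ?l\<close> by simp
    qed
    have card: "card (W - set zs) = card W - ?l"
      using l less.prems(1) by (simp add: card_Diff_subset distinct_card)
    then have "card (W - set zs) > 0" using l less.prems(3) by linarith
    then obtain x' where x': "x' \<in> W - set zs" by (metis card.empty equals0I less_irrefl)
    have md: "missing_deg x (W - set zs) + ?l \<le> k" if x: "x \<in> W - set zs" for x
      using stuck[OF x] missing_deg_Diff[OF less.prems(1) l(3), of x] less.prems(2)[of x] x by auto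
    have lk: "?l \<le> k" using md[OF x'] by simp
    have "\<exists>zs'. cycle_list zs' \<and> set zs' \<subseteq> W - set zs \<and> length zs' = j"
    proof (rule less.hyps[of "W - set zs" "k - ?l"])
      show "card (W - set zs) < card W" using card l less.prems(3) by linarith
      show "k - ?l + j \<le> card (W - set zs)" using card lk less.prems(3) by linarith
      show "missing_deg x (W - set zs) \<le> k - ?l" if "x \<in> W - set zs" for x using md[OF that] by linarith
    qed (use less.prems in auto)
    then show ?thesis by blast
  qed
qed

section \<open>Strong components and exchanges\<close>

definition strong_class :: "'a set \<Rightarrow> 'a \<Rightarrow> 'a set" where
  "strong_class A y = {v \<in> A. (y, v) \<in> (induced_rel E A)\<^sup>* \<and> (v, y) \<in> (induced_rel E A)\<^sup>*}"

lemma strong_class_self: "y \<in> A \<Longrightarrow> y \<in> strong_class A y"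
  by (simp add: strong_class_def)

lemma strong_class_disjoint: "x \<notin> strong_class A y \<Longrightarrow> x \<in> A \<Longrightarrow> strong_class A x \<inter> strong_class A y = {}"
  unfolding strong_class_def by (auto intro: rtrancl_trans)

text \<open>A vertex joined to \<open>y\<close> in both directions lies in the component of
  \<open>y\<close>, so each vertex outside it costs \<open>y\<close> a missing arc.\<close>

lemma strong_class_missing_deg:
  assumes "finite A" "y \<in> A"
  shows "card A \<le> missing_deg y A + card (strong_class A y)"
proof -
  let ?K = "strong_class A y"
  have K: "?K \<subseteq> A" unfolding strong_class_def by blast
  have "card (A - ?K) \<le> missing_deg y (A - ?K)"
  proof (rule missing_deg_ge_card)
    show "y \<notin> A - ?K" using strong_class_self assms by blast
    fix v assume v: "v \<in> A - ?K"
    have "\<not> (E y v \<and> E v y)"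
    proof
      assume "E y v \<and> E v y"
      then have "(y, v) \<in> induced_rel E A" "(v, y) \<in> induced_rel E A" using v assms unfolding induced_rel_def by auto
      then show False using v unfolding strong_class_def by blast
    qed
    then show "1 \<le> missing y v" by (auto simp: missing_def)
  qed (use assms in auto)
  also have "\<dots> \<le> missing_deg y A" using assms by (intro missing_deg_mono) auto
  finally show ?thesis using K assms finite_subset[OF K] by (simp add: card_Diff_subset)
qed

text \<open>A walk from \<open>y\<close> to a vertex of its component, or back, never leaves the
  component, so deleting \<open>x\<close> does no harm; and \<open>z\<close> joins the component
  directly through \<open>y\<close>.\<close>

lemma strong_class_exchange:
  assumes y: "y \<in> A" "x \<notin> strong_class A y" "missing y z = 0"
  shows "insert z (strong_class A y) \<subseteq> strong_class (insert z (A - {x})) y"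
proof -
  let ?K = "strong_class A y" and ?R = "induced_rel E A" and ?A' = "insert z (A - {x})"
  have 1: "(y, v) \<in> ?R\<^sup>* \<Longrightarrow> (v, y) \<in> ?R\<^sup>* \<longrightarrow> (y, v) \<in> (induced_rel E ?K)\<^sup>*" for v
  proof (induction rule: rtrancl_induct)
    case (step v w)
    show ?case
    proof
      assume w: "(w, y) \<in> ?R\<^sup>*"
      then have v: "(v, y) \<in> ?R\<^sup>*" using step.hyps by (meson converse_rtrancl_into_rtrancl)
      moreover have "(v, w) \<in> induced_rel E ?K"
        using step.hyps v w unfolding induced_rel_def strong_class_def
        by (auto intro: rtrancl_into_rtrancl)
      ultimately show "(y, w) \<in> (induced_rel E ?K)\<^sup>*" using step.IH by (meson rtrancl_into_rtrancl)
    qed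
  qed simp
  have 2: "(v, y) \<in> ?R\<^sup>* \<Longrightarrow> (y, v) \<in> ?R\<^sup>* \<longrightarrow> (v, y) \<in> (induced_rel E ?K)\<^sup>*" for v
  proof (induction rule: converse_rtrancl_induct)
    case (step v w)
    show ?case
    proof
      assume v: "(y, v) \<in> ?R\<^sup>*"
      then have w: "(y, w) \<in> ?R\<^sup>*" using step.hyps by (meson rtrancl_into_rtrancl)
      moreover have "(v, w) \<in> induced_rel E ?K"
        using step.hyps v w unfolding induced_rel_def strong_class_def
        by (auto intro: converse_rtrancl_into_rtrancl)
      ultimately show "(v, y) \<in> (induced_rel E ?K)\<^sup>*" using step.IH by (meson converse_rtrancl_into_rtrancl)
    qed
  qed simp
  have KA: "?K \<subseteq> ?A'" using y(2) unfolding strong_class_def by auto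
  then have mono: "(induced_rel E ?K)\<^sup>* \<subseteq> (induced_rel E ?A')\<^sup>*"
    by (intro rtrancl_mono) (auto simp: induced_rel_def)
  have "v \<in> strong_class ?A' y" if v: "v \<in> ?K" for v
  proof -
    have "(y, v) \<in> ?R\<^sup>*" "(v, y) \<in> ?R\<^sup>*" using v unfolding strong_class_def by auto
    then show ?thesis using 1 2 mono KA v unfolding strong_class_def[of ?A'] by blast
  qed
  moreover have "z \<in> strong_class ?A' y"
  proof -
    have "y \<in> ?A'" using strong_class_self y KA by blast
    then have "(y, z) \<in> induced_rel E ?A'" "(z, y) \<in> induced_rel E ?A'"
      using y(3) unfolding induced_rel_def by (auto simp: missing_eq_0_iff)
    then show ?thesis unfolding strong_class_def by blast
  qed
  ultimately show ?thesis by blast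
qed

text \<open>Deleting \<open>n2\<close> vertices of \<open>W\<close> leaves at least
  \<open>k + 2\<close> vertices, which is the degree hypothesis of \<open>cyclable\<close>. Mutual
  reachability is arranged by choosing the deleted set so that a component of the rest has the most
  vertices of \<open>W\<close>.\<close>

lemma cycle_with_exact_count:
  assumes fin: "finite V" and WV: "W \<subseteq> V"
    and indep: "\<And>u v. u \<in> V \<Longrightarrow> v \<in> V \<Longrightarrow> E u v \<Longrightarrow> u \<in> W \<or> v \<in> W"
    and deg: "\<And>x. x \<in> W \<Longrightarrow> missing_deg x V \<le> k"
    and n: "2 * k + 1 \<le> card V" "n2 + k + 2 \<le> card V" "1 \<le> n1" "card W = n1 + n2"
  shows "\<exists>zs. cycle_list zs \<and> set zs \<subseteq> V \<and> card (W \<inter> set zs) = n1"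
proof -
  have finW: "finite W" using fin WV finite_subset by blast
  define rest where "rest W1 = V - (W - W1)" for W1
  define cand where "cand p \<longleftrightarrow> fst p \<subseteq> W \<and> card (fst p) = n1 \<and> snd p \<in> fst p" for p
  define val where "val p = card (W \<inter> strong_class (rest (fst p)) (snd p))" for p
  obtain W0 where W0: "W0 \<subseteq> W" "card W0 = n1" using n(4) by (metis le_add1 obtain_subset_with_card_n)
  then obtain y0 where "cand (W0, y0)" using n(3) unfolding cand_def by fastforce
  then have "\<exists>p. cand p \<and> (\<forall>q. cand q \<longrightarrow> val q \<le> val p)"
    using finW by (intro ex_has_greatest_nat[of cand _ _ "Suc (card W)"])
      (auto simp: val_def less_Suc_eq_le intro: card_mono)
  then obtain W1 y where "cand (W1, y)" and vmax: "\<And>q. cand q \<Longrightarrow> val q \<le> val (W1, y)" by force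
  then have W1: "W1 \<subseteq> W" "card W1 = n1" and y: "y \<in> W1" unfolding cand_def by auto
  define A where "A = rest W1"
  have A: "finite A" "W1 \<subseteq> A" "W \<inter> A = W1" "A \<subseteq> V" "V - A = W - W1"
    using fin W1 WV unfolding A_def rest_def by auto
  have cW: "card (W - W1) = n2" using W1 n(4) finW by (simp add: card_Diff_subset finite_subset)
  then have cA: "card A + n2 = card V" using fin A card_Diff_subset[of A V] card_mono[OF fin A(4)] finite_subset[OF A(4)] by simp
  have md: "missing_deg x V = missing_deg x A + missing_deg x (W - W1)" for x
    using missing_deg_Diff[OF fin A(4), of x] A(5) by simp
  have all: "W1 \<subseteq> strong_class A y"
  proof
    fix x assume x: "x \<in> W1"
    show "x \<in> strong_class A y"
    proof (rule ccontr)
      assume nx: "x \<notin> strong_class A y"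
      have xA: "x \<in> A" "y \<in> A" using x y A by auto
      have xy: "x \<noteq> y" using nx strong_class_self xA by blast
      have "card (strong_class A x) + card (strong_class A y) = card (strong_class A x \<union> strong_class A y)"
        using strong_class_disjoint[OF nx xA(1)] A(1)
        by (subst card_Un_disjoint) (auto simp: strong_class_def)
      also have "\<dots> \<le> card A" using A(1) by (intro card_mono) (auto simp: strong_class_def)
      finally have sum: "card (strong_class A x) + card (strong_class A y) \<le> card A" .
      \<comment> \<open>Otherwise \<open>y\<close> misses \<open>n2\<close> arcs to the deleted
        vertices, while \<open>x\<close> and \<open>y\<close> together miss \<open>card A\<close>
        arcs inside \<open>A\<close>; the sum \<open>card V\<close> exceeds
        \<open>2 * k\<close>.\<close>
      have "\<exists>z\<in>W - W1. missing y z = 0"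
      proof (rule ccontr)
        assume "\<not> ?thesis"
        then have "card (W - W1) \<le> missing_deg y (W - W1)"
          using finW y by (intro missing_deg_ge_card) (auto simp: Suc_le_eq)
        moreover have "missing_deg x V \<le> k" "missing_deg y V \<le> k" using deg x y W1 by auto
        ultimately show False
          using sum md[of y] md[of x] cW cA n(1)
            strong_class_missing_deg[OF A(1) xA(1)] strong_class_missing_deg[OF A(1) xA(2)] by linarith
      qed
      then obtain z where z: "z \<in> W - W1" "missing y z = 0" by blast
      have zA: "z \<notin> A" using z A by auto
      define W1' where "W1' = insert z (W1 - {x})"
      have A': "rest W1' = insert z (A - {x})"
        using z x W1 WV unfolding A_def rest_def W1'_def by auto
      have "card W1' = n1" unfolding W1'_def using z x W1 finW finite_subset[OF W1(1) finW] n(3) by simp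
      then have "cand (W1', y)" unfolding cand_def using z W1 y xy unfolding W1'_def by auto
      from vmax[OF this] have "card (W \<inter> strong_class (rest W1') y) \<le> card (W \<inter> strong_class A y)"
        unfolding val_def A_def by simp
      moreover have sub: "insert z (strong_class A y) \<subseteq> strong_class (rest W1') y"
        unfolding A' using strong_class_exchange[OF xA(2) nx z(2)] .
      moreover have "z \<notin> strong_class A y" using zA unfolding strong_class_def by auto
      then have "W \<inter> strong_class A y \<subset> W \<inter> strong_class (rest W1') y" using sub z by blast
      moreover have "finite (W \<inter> strong_class (rest W1') y)" using finW by blast
      ultimately show False using psubset_card_mono not_le by metis
    qed
  qed
  have "\<exists>zs'. cycle_list zs' \<and> W1 \<subseteq> set zs' \<and> set zs' \<subseteq> A"
  proof (rule cyclable)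
    show "finite A" "W1 \<subseteq> A" "W1 \<noteq> {}" using A y by auto
    show "u \<in> W1 \<or> v \<in> W1" if "u \<in> A" "v \<in> A" "E u v" for u v
      using that indep[of u v] A by blast
    show "missing_deg x A + 2 \<le> card A" if x: "x \<in> W1" for x
      using md[of x] deg[of x] x W1 cA n(2) by fastforce
    show "(a, b) \<in> (induced_rel E A)\<^sup>*" if "a \<in> W1" "b \<in> W1" for a b
    proof -
      have "a \<in> strong_class A y" "b \<in> strong_class A y" using that all by auto
      then have "(a, y) \<in> (induced_rel E A)\<^sup>*" "(y, b) \<in> (induced_rel E A)\<^sup>*"
        unfolding strong_class_def by auto
      then show ?thesis by (rule rtrancl_trans)
    qed
  qed
  then obtain zs where zs: "cycle_list zs" "W1 \<subseteq> set zs" "set zs \<subseteq> A" by blast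
  then have "W \<inter> set zs = W1" using A by blast
  then show ?thesis using zs W1 A by blast
qed

section \<open>Extending one cycle to two\<close>

lemma cycle_list_nth:
  assumes "cycle_list zs" "i < length zs"
  shows "E (zs ! i) (zs ! (Suc i mod length zs))"
proof (cases "Suc i < length zs")
  case True
  then show ?thesis using assms unfolding cycle_list_def by (simp add: successively_nth)
next
  case False
  then have "i = length zs - 1" "Suc i = length zs" using assms by auto
  then show ?thesis using assms unfolding cycle_list_def by (auto simp: last_conv_nth hd_conv_nth)
qed

lemma cycle_list_replace1:
  assumes "cycle_list zs" "x \<notin> set zs" "i < length zs" "2 \<le> length zs"
    and "E (zs ! i) x" "E x (zs ! ((i + 2) mod length zs))"
  shows "\<exists>zs'. cycle_list zs' \<and> set zs' = insert x (set zs - {zs ! ((i + 1) mod length zs)}) \<and> length zs' = length zs"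
proof -
  have "cycle_list (x # drop 1 (rotate (i + 1) zs))"
    using assms by (intro cycle_list_replace) auto
  moreover have "set (drop 1 (rotate (i + 1) zs)) = set zs - {zs ! ((i + 1) mod length zs)}"
    using assms by (subst set_drop_rotate) (auto simp: cycle_list_def)
  ultimately show ?thesis using assms
    by (intro exI[of _ "x # drop 1 (rotate (i + 1) zs)"]) auto
qed

lemma cycle_list_replace2:
  assumes "cycle_list zs" "x \<notin> set zs" "i < length zs" "3 \<le> length zs"
    and "E (zs ! i) x" "E x (zs ! ((i + 3) mod length zs))"
  shows "\<exists>zs'. cycle_list zs' \<and> length zs' + 1 = length zs \<and>
    set zs' = insert x (set zs - {zs ! ((i + 1) mod length zs), zs ! ((i + 2) mod length zs)})"
proof -
  have "i + 1 + 2 = i + 3" by simp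
  then have "E x (zs ! ((i + 1 + 2) mod length zs))" using assms(6) by metis
  then have "cycle_list (x # drop 2 (rotate (i + 1) zs))"
    using assms(1-5) by (intro cycle_list_replace) auto
  moreover have "{..<2::nat} = {0, 1}" by auto
  then have "set (drop 2 (rotate (i + 1) zs)) = set zs - {zs ! ((i + 1) mod length zs), zs ! ((i + 2) mod length zs)}"
    using assms by (subst set_drop_rotate) (auto simp: cycle_list_def)
  ultimately show ?thesis using assms
    by (intro exI[of _ "x # drop 2 (rotate (i + 1) zs)"]) auto
qed

lemma two_cycles_from_cycle:
  assumes fin: "finite V" and WV: "W \<subseteq> V"
    and indep: "\<And>u v. u \<in> V \<Longrightarrow> v \<in> V \<Longrightarrow> E u v \<Longrightarrow> u \<in> W \<or> v \<in> W"
    and deg: "\<And>x. x \<in> W \<Longrightarrow> missing_deg x V \<le> k"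
    and n: "2 * k + 1 \<le> card V" "n1 + k + 2 \<le> card V" "3 \<le> n1" "1 \<le> n2" "card W = n1 + n2"
    and ex: "\<exists>zs. cycle_list zs \<and> set zs \<subseteq> V \<and> card (W \<inter> set zs) = n1"
  shows "\<exists>C1 C2. cycle_list C1 \<and> cycle_list C2 \<and> set C1 \<subseteq> V \<and> set C2 \<subseteq> V \<and> set C1 \<inter> set C2 = {} \<and>
     card (W \<inter> set C1) = n1 \<and> card (W \<inter> set C2) = n2"
proof -
  have finW: "finite W" using fin WV finite_subset by blast
  define ok where "ok zs \<longleftrightarrow> cycle_list zs \<and> set zs \<subseteq> V \<and> card (W \<inter> set zs) = n1" for zs
  define c where "c = (LEAST c. \<exists>zs. ok zs \<and> length zs = c)"
  have "\<exists>c. \<exists>zs. ok zs \<and> length zs = c" using ex unfolding ok_def by blast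
  from LeastI_ex[OF this] obtain zs0 where zs0: "ok zs0" "length zs0 = c" unfolding c_def by blast
  have minc: "c \<le> length zs" if "ok zs" for zs
    unfolding c_def using that by (intro Least_le) blast
  define opt where "opt zs \<longleftrightarrow> ok zs \<and> length zs = c" for zs
  have optD: "cycle_list zs" "set zs \<subseteq> V" "card (W \<inter> set zs) = n1" "length zs = c" "distinct zs"
    "card (set zs) = c" if "opt zs" for zs
    using that unfolding opt_def ok_def cycle_list_def by (auto simp: distinct_card)
  have c3: "3 \<le> c"
  proof -
    have "card (W \<inter> set zs0) \<le> card (set zs0)" by (intro card_mono) auto
    then show ?thesis using zs0 n unfolding ok_def using card_length[of zs0] by linarith
  qed
  have outside: "W - set zs \<noteq> {}" if "opt zs" for zs
  proof
    assume "W - set zs = {}"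
    then have "W \<inter> set zs = W" by blast
    then show False using optD[OF that] n by auto
  qed

  \<comment> \<open>Otherwise \<open>x\<close> replaces two consecutive vertices, exactly one of which lies in \<open>W\<close>.\<close>
  have pair: "\<not> (E (zs ! i) x \<and> E x (zs ! ((i + 3) mod c)))"
    if zs: "opt zs" and x: "x \<in> W - set zs" and i: "i < c"
      and U: "zs ! ((i + 1) mod c) \<notin> W \<or> zs ! ((i + 2) mod c) \<notin> W" for zs x i
  proof
    assume E: "E (zs ! i) x \<and> E x (zs ! ((i + 3) mod c))"
    let ?R = "{zs ! ((i + 1) mod c), zs ! ((i + 2) mod c)}"
    note D = optD[OF zs]
    from cycle_list_replace2[OF D(1), of x i] obtain zs' where zs': "cycle_list zs'" "length zs' + 1 = c"
      "set zs' = insert x (set zs - ?R)" using D x i c3 E by auto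
    have Rsub: "?R \<subseteq> set zs" using D c3 by auto
    have "E (zs ! ((i + 1) mod c)) (zs ! ((i + 2) mod c))"
      using cycle_list_nth[OF D(1), of "(i + 1) mod c"] D c3 by (simp add: mod_Suc_eq)
    then have "zs ! ((i + 1) mod c) \<in> W \<or> zs ! ((i + 2) mod c) \<in> W"
      using indep Rsub D(2) by blast
    then have "card (W \<inter> ?R) = 1" using U
      by (cases "zs ! ((i + 1) mod c) \<in> W") auto
    moreover have "card (W \<inter> set zs') + card (W \<inter> ?R) = card (W \<inter> set zs) + 1"
      unfolding zs'(3) using x Rsub by (intro card_Int_replace) auto
    ultimately have "ok zs'" unfolding ok_def using zs' D x WV by auto
    from minc[OF this] show False using zs'(2) by simp
  qed
  have consecU: "zs ! ((i + 1) mod c) \<in> W \<or> zs ! ((i + 2) mod c) \<in> W" if zs: "opt zs" for zs i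
  proof -
    note D = optD[OF zs]
    have "E (zs ! ((i + 1) mod c)) (zs ! ((i + 2) mod c))"
      using cycle_list_nth[OF D(1), of "(i + 1) mod c"] D c3 by (simp add: mod_Suc_eq)
    moreover have "zs ! ((i + 1) mod c) \<in> V" "zs ! ((i + 2) mod c) \<in> V" using D c3 by (intro subsetD[OF D(2)] nth_mem; auto)+
    ultimately show ?thesis using indep by blast
  qed
  \<comment> \<open>Every vertex outside \<open>W\<close> lies in two windows of two consecutive
    positions. A window contains at most one such vertex, and by \<open>pair\<close> it then
    accounts for a missing arc of \<open>x\<close>.\<close>
  have many: "2 * (c - n1) \<le> missing_deg x (set zs)" if zs: "opt zs" and x: "x \<in> W - set zs" for zs x
  proof -
    note D = optD[OF zs]
    have "(\<Sum>i<length zs. of_bool (zs ! ((i + 1) mod length zs) \<notin> W) + of_bool (zs ! ((i + 2) mod length zs) \<notin> W))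
      \<le> missing_deg x (set zs)"
    proof -
      have "of_bool (zs ! ((i + 1) mod c) \<notin> W) + of_bool (zs ! ((i + 2) mod c) \<notin> W)
        \<le> (of_bool (\<not> E (zs ! i) x) + of_bool (\<not> E x (zs ! ((i + 3) mod c))) :: nat)" if "i < c" for i
        using pair[OF zs x that] consecU[OF zs, of i] by auto
      then show ?thesis using missing_deg_nth[OF D(5), of x 3] x D(4) by (auto intro!: sum_mono)
    qed
    moreover have "(\<Sum>z\<in>set zs. of_bool (z \<notin> W)) = c - n1"
    proof -
      have "(\<Sum>z\<in>set zs. of_bool (z \<notin> W)) = card (set zs - W)" by (simp add: Diff_eq Collect_neg_eq)
      also have "\<dots> = c - n1" using D card_Diff_subset_Int[of "set zs" W] by (simp add: Int_commute)
      finally show ?thesis .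
    qed
    ultimately show ?thesis
      using sum_nth_shift[OF D(5), of "\<lambda>z. of_bool (z \<notin> W) :: nat" 1]
        sum_nth_shift[OF D(5), of "\<lambda>z. of_bool (z \<notin> W) :: nat" 2] unfolding sum.distrib by linarith
  qed

  \<comment> \<open>If \<open>x\<close> could replace a vertex outside \<open>W\<close>, then afterwards \<open>y\<close> could replace no two
    consecutive vertices of the new cycle, so \<open>y\<close> would miss at least \<open>c - 2\<close> arcs to it.\<close>
  have nofree: "\<not> (E (zs ! i) x \<and> E x (zs ! ((i + 2) mod c)))"
    if zs: "opt zs" and xy: "x \<in> W - set zs" "y \<in> W - set zs" "x \<noteq> y" and i: "i < c"
      and U: "zs ! ((i + 1) mod c) \<notin> W" 
      and M: "missing_deg x (set zs) + missing_deg y (set zs) < c" for zs x y i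
  proof
    assume E: "E (zs ! i) x \<and> E x (zs ! ((i + 2) mod c))"
    note D = optD[OF zs]
    \<comment> \<open>The rotation puts the replaceable vertex \<open>u\<close> at position 0, so
      that \<open>vs\<close> differs from \<open>ws\<close> only there.\<close>
    define ws where "ws = rotate (i + 1) zs"
    have ws: "opt ws" using zs cycle_list_rotate[of zs "i + 1"] unfolding opt_def ok_def ws_def by auto
    note Dw = optD[OF ws]
    have setw: "set ws = set zs" unfolding ws_def by simp
    define u where "u = hd ws"
    define rest where "rest = tl ws"
    have wsu: "ws = u # rest" using Dw(4) c3 unfolding u_def rest_def by (cases ws) auto
    have u: "u = zs ! ((i + 1) mod c)" using D c3 unfolding u_def ws_def by (subst hd_rotate_conv_nth) auto
    have uW: "u \<notin> W" using U u by simp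
    have n1c: "n1 < c"
    proof -
      have "W \<inter> set zs \<subset> set zs" using uW u D c3 by (metis Int_lower2 IntD1 c3 mod_less_divisor nth_mem psubsetI setw
          wsu list.set_intros(1))
      then show ?thesis using D psubset_card_mono[of "set zs"] by auto
    qed
    define vs where "vs = x # rest"
    have vs: "cycle_list vs"
    proof -
      have "cycle_list (x # drop 1 (rotate (i + 1) zs))"
        using D xy i E c3 by (intro cycle_list_replace) auto
      then show ?thesis unfolding vs_def using wsu ws_def by simp
    qed
    have lenvs: "length vs = c" using Dw wsu unfolding vs_def by simp
    have setvs: "set vs = insert x (set ws - {u})" using wsu Dw(5) unfolding vs_def by auto
    have cvs: "card (W \<inter> set vs) = n1 + 1"
    proof -
      have "W \<inter> {u} = {}" using uW by auto
      moreover have "card (W \<inter> set vs) + card (W \<inter> {u}) = card (W \<inter> set ws) + 1"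
        unfolding setvs using xy setw wsu by (intro card_Int_replace) auto
      ultimately show ?thesis using Dw(3) by simp
    qed
    have same: "vs ! l = ws ! l" if "0 < l" for l using that wsu vs_def by (cases l) auto
    \<comment> \<open>The two excluded windows are those with an end at position 0. A window
      containing a vertex outside \<open>W\<close> falls under \<open>pair\<close>. Otherwise two
      vertices of \<open>W\<close> in \<open>vs\<close> would give way to \<open>y\<close>; as
      \<open>vs\<close> has \<open>n1 + 1\<close> of them, the result would have \<open>n1\<close>
      and be shorter.\<close>
    have big: "1 \<le> (of_bool (\<not> E (ws ! l) y) + of_bool (\<not> E y (ws ! ((l + 3) mod c))) :: nat)"
      if l: "l < c" "l \<noteq> 0" "(l + 3) mod c \<noteq> 0" for l
    proof (cases "ws ! ((l + 1) mod c) \<in> W \<and> ws ! ((l + 2) mod c) \<in> W")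
      case False
      then show ?thesis using pair[OF ws _ l(1)] xy setw by auto
    next
      case True
      let ?p = "(l + 1) mod c" and ?q = "(l + 2) mod c"
      have pq: "?p \<noteq> 0" "?q \<noteq> 0" using True uW wsu by (metis nth_Cons_0)+
      have pq': "?p < c" "?q < c" "?p \<noteq> ?q"
        using c3 pq cycle_list_nth[OF Dw(1), of ?p] Dw(4) irrefl by (auto simp: mod_Suc_eq)
      show ?thesis
      proof (rule ccontr)
        assume "\<not> ?thesis"
        then have "E (ws ! l) y" "E y (ws ! ((l + 3) mod c))" by (auto simp: of_bool_def split: if_splits)
        then have "E (vs ! l) y" "E y (vs ! ((l + 3) mod c))" using same l by auto
        moreover have "y \<notin> set vs" using xy setvs setw by auto
        ultimately obtain zs' where zs': "cycle_list zs'" "length zs' + 1 = c" "set zs' = insert y (set vs - {vs ! ?p, vs ! ?q})"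
          using cycle_list_replace2[OF vs, of y l] lenvs l c3 by auto
        have Rsub: "{vs ! ?p, vs ! ?q} \<subseteq> set vs" using pq' lenvs by auto
        have "card (W \<inter> {vs ! ?p, vs ! ?q}) = 2"
        proof -
          have "vs ! ?p \<noteq> vs ! ?q" using vs lenvs pq' nth_eq_iff_index_eq[of vs] unfolding cycle_list_def by blast
          moreover have "W \<inter> {vs ! ?p, vs ! ?q} = {vs ! ?p, vs ! ?q}" using True same pq by auto
          ultimately show ?thesis by simp
        qed
        moreover have "card (W \<inter> set zs') + card (W \<inter> {vs ! ?p, vs ! ?q}) = card (W \<inter> set vs) + 1"
          unfolding zs'(3) using xy Rsub \<open>y \<notin> set vs\<close> by (intro card_Int_replace) auto
        ultimately have "card (W \<inter> set zs') = n1" using cvs by simp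
        moreover have "set zs' \<subseteq> V" unfolding zs'(3) using xy WV setvs Dw(2) by auto
        ultimately have "ok zs'" unfolding ok_def using zs' by auto
        from minc[OF this] show False using zs'(2) by simp
      qed
    qed
    have "c - 2 \<le> missing_deg y (set ws)"
    proof -
      have c4: "3 < c" using n1c n by linarith
      have "(l + 3) mod c \<noteq> 0" if "l < c" "l \<noteq> c - 3" for l
      proof (cases "l + 3 < c")
        case False
        then have "(l + 3) mod c = l + 3 - c" using that c4 by (subst mod_if) (auto simp: mod_if)
        then show ?thesis using that False by auto
      qed auto
      then have "(\<Sum>l\<in>{..<c} - {0, c - 3}. 1) \<le> (\<Sum>l\<in>{..<c} - {0, c - 3}. of_bool (\<not> E (ws ! l) y) + of_bool (\<not> E y (ws ! ((l + 3) mod c))) :: nat)"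
        by (intro sum_mono big) auto
      also have "\<dots> \<le> (\<Sum>l<c. of_bool (\<not> E (ws ! l) y) + of_bool (\<not> E y (ws ! ((l + 3) mod c))) :: nat)"
        by (intro sum_mono2) auto
      also have "\<dots> = missing_deg y (set ws)"
        using missing_deg_nth[OF Dw(5), of y 3] xy setw Dw(4) by simp
      finally have "card ({..<c} - {0, c - 3}) \<le> missing_deg y (set ws)" by simp
      moreover have "card ({..<c} - {0, c - 3}) = c - 2" using c4 by (subst card_Diff_subset) auto
      ultimately show ?thesis by simp
    qed
    \<comment> \<open>Since \<open>u\<close> is outside \<open>W\<close>, \<open>many\<close> gives
      \<open>x\<close> at least the two missing arcs that bring the sum up to
      \<open>c\<close>.\<close>
    then show False using M many[OF zs xy(1)] n1c setw by simp
  qed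

  define val where "val p = card (W \<inter> strong_class (V - set (fst p)) (snd p))" for p
  define cand where "cand p \<longleftrightarrow> opt (fst p) \<and> snd p \<in> W - set (fst p)" for p
  have "opt zs0" using zs0 unfolding opt_def by simp
  then obtain y0 where "cand (zs0, y0)" using outside[of zs0] unfolding cand_def by auto
  then have "\<exists>p. cand p \<and> (\<forall>q. cand q \<longrightarrow> val q \<le> val p)"
    using finW by (intro ex_has_greatest_nat[of cand _ _ "Suc (card W)"])
      (auto simp: val_def less_Suc_eq_le intro: card_mono)
  then obtain zs y where "cand (zs, y)" and vmax: "\<And>q. cand q \<Longrightarrow> val q \<le> val (zs, y)" by force
  then have zs: "opt zs" and y: "y \<in> W - set zs" unfolding cand_def by auto
  note D = optD[OF zs]
  define A where "A = V - set zs"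
  have A: "finite A" "y \<in> A" "W \<inter> A = W - set zs" unfolding A_def using fin y WV by auto
  have cA: "card A + c = card V" unfolding A_def using D fin card_mono[OF fin D(2)] by (simp add: card_Diff_subset)
  have all: "W - set zs \<subseteq> strong_class A y"
  proof
    fix x assume x: "x \<in> W - set zs"
    show "x \<in> strong_class A y"
    proof (rule ccontr)
      assume nx: "x \<notin> strong_class A y"
      have xA: "x \<in> A" using x WV unfolding A_def by auto
      have xy: "x \<noteq> y" using nx strong_class_self A by blast
      \<comment> \<open>Lying in different components, \<open>x\<close> and \<open>y\<close>
        together miss at least \<open>card A\<close> arcs inside \<open>A\<close>, out of at most
        \<open>2 * k < card V\<close>.\<close>
      have M: "missing_deg x (set zs) + missing_deg y (set zs) < c"
      proof -
        have "card (strong_class A x) + card (strong_class A y) = card (strong_class A x \<union> strong_class A y)"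
          using strong_class_disjoint[OF nx xA] A(1)
          by (subst card_Un_disjoint) (auto simp: strong_class_def)
        also have "\<dots> \<le> card A" using A(1) by (intro card_mono) (auto simp: strong_class_def)
        finally have "card (strong_class A x) + card (strong_class A y) \<le> card A" .
        moreover have "missing_deg x V = missing_deg x A + missing_deg x (set zs)"
          "missing_deg y V = missing_deg y A + missing_deg y (set zs)"
          unfolding A_def by (intro missing_deg_Diff[OF fin D(2)])+
        moreover have "missing_deg x V \<le> k" "missing_deg y V \<le> k" using deg x y by auto
        ultimately show ?thesis
          using strong_class_missing_deg[OF A(1) xA] strong_class_missing_deg[OF A(1,2)] cA n(1) by linarith
      qed
      \<comment> \<open>Charge position \<open>i\<close> with the two arcs that \<open>x\<close>
        needs to replace its successor and with the arcs missing between \<open>y\<close> and that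
        successor. By \<open>M\<close> the charges sum to less than \<open>c\<close>, so one is
        zero.\<close>
      have "\<exists>i<c. E (zs ! i) x \<and> E x (zs ! ((i + 2) mod c)) \<and> missing y (zs ! ((i + 1) mod c)) = 0"
      proof (rule ccontr)
        assume no: "\<not> ?thesis"
        have "missing_deg y (set zs) = (\<Sum>i<length zs. missing y (zs ! ((i + 1) mod length zs)))"
          using sum_nth_shift[OF D(5), of "missing y" 1] y missing_deg_not_in[of y "set zs"] by simp
        then have "missing_deg x (set zs) + missing_deg y (set zs) = (\<Sum>i<c. of_bool (\<not> E (zs ! i) x)
            + of_bool (\<not> E x (zs ! ((i + 2) mod c))) + missing y (zs ! ((i + 1) mod c)))"
          using missing_deg_nth[OF D(5), of x 2] x D(4) unfolding sum.distrib by auto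
        also have "\<dots> \<ge> (\<Sum>i<c. 1)"
          by (intro sum_mono) (use no in \<open>auto simp: Suc_le_eq\<close>)
        finally show False using M by simp
      qed
      then obtain i where i: "i < c" "E (zs ! i) x" "E x (zs ! ((i + 2) mod c))"
        "missing y (zs ! ((i + 1) mod c)) = 0" by blast
      define z where "z = zs ! ((i + 1) mod c)"
      have zW: "z \<in> W" using nofree[OF zs x y xy i(1) _ M] i unfolding z_def by blast
      have zin: "z \<in> set zs" unfolding z_def using D c3 by auto
      obtain zs' where zs': "cycle_list zs'" "set zs' = insert x (set zs - {z})" "length zs' = c"
        using cycle_list_replace1[OF D(1), of x i] D x i c3 unfolding z_def by auto
      have "card (W \<inter> set zs') + card (W \<inter> {z}) = card (W \<inter> set zs) + 1"
        unfolding zs'(2) using x zin by (intro card_Int_replace) auto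
      then have "card (W \<inter> set zs') = n1" using zW D by simp
      then have opt': "opt zs'" unfolding opt_def ok_def using zs' D(2) x WV by auto
      have A': "V - set zs' = insert z (A - {x})" unfolding A_def zs'(2) using zin D(2) x by auto
      have sub: "insert z (strong_class A y) \<subseteq> strong_class (V - set zs') y"
        unfolding A' using strong_class_exchange[OF A(2) nx, of z] i(4) unfolding z_def by blast
      have "cand (zs', y)" unfolding cand_def using opt' zs' y xy by auto
      from vmax[OF this] have "card (W \<inter> strong_class (V - set zs') y) \<le> card (W \<inter> strong_class A y)"
        unfolding val_def A_def by simp
      moreover have "z \<notin> strong_class A y" using zin unfolding strong_class_def A_def by auto
      then have "W \<inter> strong_class A y \<subset> W \<inter> strong_class (V - set zs') y"
        using sub zW by blast
      moreover have "finite (W \<inter> strong_class (V - set zs') y)" using finW by blast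
      ultimately show False using psubset_card_mono not_le by metis
    qed
  qed
  have "\<exists>zs'. cycle_list zs' \<and> W - set zs \<subseteq> set zs' \<and> set zs' \<subseteq> A"
  proof (rule cyclable)
    show "finite A" "W - set zs \<subseteq> A" "W - set zs \<noteq> {}" using A y WV unfolding A_def by auto
    show "u \<in> W - set zs \<or> v \<in> W - set zs" if "u \<in> A" "v \<in> A" "E u v" for u v
      using that indep[of u v] unfolding A_def by auto
    \<comment> \<open>A cycle with \<open>c - n1\<close> vertices outside \<open>W\<close> leaves
      that many fewer vertices in \<open>A\<close>, but by \<open>many\<close> the missing degree
      drops by at least twice as much.\<close>
    show "missing_deg x A + 2 \<le> card A" if x: "x \<in> W - set zs" for x
    proof -
      have "missing_deg x A + missing_deg x (set zs) \<le> k"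
        using missing_deg_Diff[OF fin D(2), of x] deg[of x] x unfolding A_def by auto
      moreover have "n1 \<le> c" using D card_mono[of "set zs" "W \<inter> set zs"] by auto
      ultimately show ?thesis using many[OF zs x] cA n(2) by linarith
    qed
    show "(a, b) \<in> (induced_rel E A)\<^sup>*" if "a \<in> W - set zs" "b \<in> W - set zs" for a b
    proof -
      have "a \<in> strong_class A y" "b \<in> strong_class A y" using that all by auto
      then have "(a, y) \<in> (induced_rel E A)\<^sup>*" "(y, b) \<in> (induced_rel E A)\<^sup>*"
        unfolding strong_class_def by auto
      then show ?thesis by (rule rtrancl_trans)
    qed
  qed
  then obtain zs' where zs': "cycle_list zs'" "W - set zs \<subseteq> set zs'" "set zs' \<subseteq> A" by blast
  have "W \<inter> set zs' = W - set zs" using zs' unfolding A_def by auto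
  moreover have "card (W - set zs) = card W - card (W \<inter> set zs)"
    using finW by (intro card_Diff_subset_Int) auto
  ultimately have "card (W \<inter> set zs') = n2" using D(3) n(5) by simp
  moreover have "set zs' \<subseteq> V" "set zs \<inter> set zs' = {}" using zs'(3) unfolding A_def by auto
  ultimately show ?thesis using zs'(1) D(1,2,3) by blast
qed

section \<open>Balanced partitions\<close>

lemma unreachable_cut:
  assumes "x \<in> A" "y \<in> A" "(x, y) \<notin> (induced_rel E A)\<^sup>*"
  obtains S T where "S \<union> T = A" "S \<inter> T = {}" "x \<in> S" "y \<in> T" "\<And>a b. a \<in> S \<Longrightarrow> b \<in> T \<Longrightarrow> \<not> E a b"
proof -
  define S where "S = {v \<in> A. (x, v) \<in> (induced_rel E A)\<^sup>*}"
  have "\<not> E a b" if "a \<in> S" "b \<in> A - S" for a b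
  proof
    assume "E a b"
    then have "(a, b) \<in> induced_rel E A" "(x, a) \<in> (induced_rel E A)\<^sup>*"
      using that unfolding S_def induced_rel_def by auto
    then have "(x, b) \<in> (induced_rel E A)\<^sup>*" by (meson rtrancl_into_rtrancl)
    then show False using that unfolding S_def by blast
  qed
  then show ?thesis using that[of S "A - S"] assms unfolding S_def by auto
qed

lemma cut_missing_deg:
  assumes "finite A" "S \<union> T = A" "S \<inter> T = {}" "\<And>a b. a \<in> S \<Longrightarrow> b \<in> T \<Longrightarrow> \<not> E a b"
  shows "a \<in> S \<Longrightarrow> card T \<le> missing_deg a A" "b \<in> T \<Longrightarrow> card S \<le> missing_deg b A"
proof -
  have fin: "finite S" "finite T" using assms(1,2) by auto
  show "card T \<le> missing_deg a A" if a: "a \<in> S"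
  proof -
    have "card T \<le> missing_deg a T"
      using fin a assms(3,4) by (intro missing_deg_ge_card) (auto simp: missing_def)
    also have "\<dots> \<le> missing_deg a A" using assms by (intro missing_deg_mono) auto
    finally show ?thesis .
  qed
  show "card S \<le> missing_deg b A" if b: "b \<in> T"
  proof -
    have "card S \<le> missing_deg b S"
      using fin b assms(3,4) by (intro missing_deg_ge_card) (auto simp: missing_def)
    also have "\<dots> \<le> missing_deg b A" using assms by (intro missing_deg_mono) auto
    finally show ?thesis .
  qed
qed

text \<open>These are the hypotheses of \<open>cyclable\<close> with all of \<open>A\<close> as
  targets, when the independence condition is vacuous; they yield a Hamiltonian cycle of
  \<open>A\<close>.\<close>

definition dense_strong :: "'a set \<Rightarrow> bool" where
  "dense_strong A \<longleftrightarrow> (\<forall>x\<in>A. missing_deg x A + 2 \<le> card A) \<and> (\<forall>x\<in>A. \<forall>y\<in>A. (x, y) \<in> (induced_rel E A)\<^sup>*)"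

lemma dense_strong_cycle_list:
  assumes "finite A" "A \<noteq> {}" "dense_strong A"
  shows "\<exists>zs. cycle_list zs \<and> set zs = A"
  using cyclable[of A A] assms unfolding dense_strong_def by blast

section \<open>Missing arcs across a bipartition\<close>

definition missing_between :: "'a set \<Rightarrow> 'a set \<Rightarrow> nat" where
  "missing_between A B = (\<Sum>a\<in>A. missing_deg a B)"

lemma missing_between_commute:
  assumes "A \<inter> B = {}"
  shows "missing_between A B = missing_between B A"
proof -
  have "missing_between A B = (\<Sum>a\<in>A. \<Sum>b\<in>B. missing a b)"
    unfolding missing_between_def using assms by (intro sum.cong missing_deg_not_in) auto
  also have "\<dots> = (\<Sum>b\<in>B. \<Sum>a\<in>A. missing b a)"
    by (subst sum.swap) (simp add: missing_commute)
  also have "\<dots> = missing_between B A"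
    unfolding missing_between_def using assms by (intro sum.cong missing_deg_not_in[symmetric]) auto
  finally show ?thesis .
qed

text \<open>Arcs missing between \<open>x\<close> and \<open>y\<close> are counted in both
  \<open>missing_deg x B\<close> and \<open>missing_deg y A\<close>, yet still cross after the
  exchange; this explains the correction \<open>2 * missing x y\<close>.\<close>

lemma missing_between_swap:
  assumes fin: "finite A" "finite B" "A \<inter> B = {}" and xy: "x \<in> A" "y \<in> B"
  shows "missing_between (insert y (A - {x})) (insert x (B - {y})) + missing_deg x B + missing_deg y A =
    missing_between A B + missing_deg x A + missing_deg y B + 2 * missing x y"
proof -
  let ?B' = "insert x (B - {y})"
  have nin: "x \<notin> B" "y \<notin> A" using fin xy by auto
  have 1: "missing_deg a ?B' + missing a y = missing_deg a B + missing a x" if a: "a \<in> A - {x}" for a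
  proof -
    have "missing_deg a ?B' = missing a x + (\<Sum>b\<in>B - {y}. missing a b)"
      using a fin xy nin by (subst missing_deg_not_in) auto
    moreover have "missing_deg a B = missing a y + (\<Sum>b\<in>B - {y}. missing a b)"
      using a fin xy by (subst missing_deg_not_in) (auto intro: sum.remove)
    ultimately show ?thesis by simp
  qed
  have 2: "(\<Sum>a\<in>A - {x}. missing_deg a ?B') + (\<Sum>a\<in>A - {x}. missing a y) =
    (\<Sum>a\<in>A - {x}. missing_deg a B) + (\<Sum>a\<in>A - {x}. missing a x)"
    unfolding sum.distrib[symmetric] by (intro sum.cong refl 1)
  have 3: "(\<Sum>a\<in>A - {x}. missing a x) = missing_deg x A"
    unfolding missing_deg_def by (intro sum.cong refl missing_commute)
  have 4: "missing_deg y A = missing x y + (\<Sum>a\<in>A - {x}. missing a y)"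
  proof -
    have "missing_deg y A = (\<Sum>a\<in>A. missing a y)"
      using fin xy by (subst missing_deg_not_in) (auto intro: sum.cong missing_commute)
    then show ?thesis using fin xy by (simp add: sum.remove)
  qed
  have 5: "missing_between A B = missing_deg x B + (\<Sum>a\<in>A - {x}. missing_deg a B)"
    unfolding missing_between_def using fin xy by (simp add: sum.remove)
  have 6: "missing_between (insert y (A - {x})) ?B' = missing_deg y ?B' + (\<Sum>a\<in>A - {x}. missing_deg a ?B')"
    unfolding missing_between_def using fin xy by (subst sum.insert) auto
  have 7: "missing_deg y ?B' = missing x y + missing_deg y B"
  proof -
    have "?B' - {y} = insert x (B - {y})" using fin xy by auto
    then show ?thesis unfolding missing_deg_def using fin(2) nin by (simp add: missing_commute)
  qed
  show ?thesis using 2 3 4 5 6 7 by linarith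
qed

lemma missing_between_ge:
  assumes "finite A" "\<And>a. a \<in> A \<Longrightarrow> l \<le> missing_deg a B"
  shows "card A * l \<le> missing_between A B"
  unfolding missing_between_def using sum_bounded_below[of A l "\<lambda>a. missing_deg a B"] assms by simp

lemma missing_between_Un_left: "finite A \<Longrightarrow> finite B \<Longrightarrow> A \<inter> B = {} \<Longrightarrow> missing_between (A \<union> B) C = missing_between A C + missing_between B C"
  unfolding missing_between_def by (rule sum.union_disjoint)

lemma missing_between_Un_right:
  assumes "finite B" "finite C" "B \<inter> C = {}"
  shows "missing_between A (B \<union> C) = missing_between A B + missing_between A C"
  unfolding missing_between_def using missing_deg_Un[OF assms] by (simp add: sum.distrib)

text \<open>Exchanging \<open>T\<close> for an equally large part \<open>R\<close> of
  \<open>B\<close> makes the arcs missing from \<open>S\<close> to \<open>T\<close> cross the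
  partition. Maximality bounds this gain by what the exchange loses, and an \<open>R\<close> that is
  below average for \<open>g\<close> turns the bound into one independent of
  \<open>R\<close>.\<close>

lemma missing_cut_averaging:
  assumes fin: "finite S" "finite T" "finite B" "S \<inter> T = {}" "(S \<union> T) \<inter> B = {}"
    and ST: "\<And>a b. a \<in> S \<Longrightarrow> b \<in> T \<Longrightarrow> \<not> E a b" and card: "card S + card T = card B"
    and max: "\<And>R. R \<subseteq> B \<Longrightarrow> card R = card T \<Longrightarrow> missing_between (S \<union> R) (T \<union> (B - R)) \<le> missing_between (S \<union> T) B"
  shows "card B * (card S * card T) \<le> card S * missing_between T B + card T * missing_between S B"
proof -
  define g where "g y = int (missing_deg y S) - int (missing_deg y T)" for y
  have dis: "S \<inter> B = {}" "T \<inter> B = {}" using fin by auto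
  have sumg: "sum g B = int (missing_between S B) - int (missing_between T B)"
    using missing_between_commute[OF dis(1)] missing_between_commute[OF dis(2)]
    unfolding g_def sum_subtractf by (simp add: missing_between_def)
  obtain R where R: "R \<subseteq> B" "card R = card T" "int (card B) * sum g R \<le> int (card T) * sum g B"
    using exists_subset_below_average[of B "card T" g] fin card by auto
  have finR: "finite R" "finite (B - R)" using R fin finite_subset by auto
  have sumR: "sum g R = int (missing_between R S) - int (missing_between R T)"
    unfolding g_def sum_subtractf by (simp add: missing_between_def)
  have RS: "R \<inter> S = {}" "T \<inter> (B - R) = {}" "S \<inter> R = {}" "(B - R) \<inter> S = {}" using R dis by auto
  have ST': "card S * card T \<le> missing_between S T"
    by (intro missing_between_ge fin missing_deg_ge_card)
      (use fin ST in \<open>auto simp: missing_def\<close>)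
  \<comment> \<open>The arcs missing between \<open>R\<close> and \<open>B - R\<close> are simply
    dropped.\<close>
  have "missing_between (S \<union> R) (T \<union> (B - R)) \<ge> missing_between S T + missing_between S (B - R) + missing_between R T"
    using fin finR RS by (simp add: missing_between_Un_left missing_between_Un_right)
  moreover have "missing_between S B = missing_between S R + missing_between S (B - R)"
    using missing_between_Un_right[of R "B - R" S] finR R(1) by (simp add: Un_absorb1)
  moreover have "missing_between S R = missing_between R S" by (rule missing_between_commute[OF RS(3)])
  moreover have "missing_between (S \<union> T) B = missing_between S B + missing_between T B" using fin by (simp add: missing_between_Un_left)
  ultimately have "card S * card T + missing_between R T \<le> missing_between T B + missing_between R S"
    using max[OF R(1,2)] ST' by linarith
  then have "int (card S * card T) \<le> int (missing_between T B) + sum g R" unfolding sumR by linarith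
  then have "int (card B) * int (card S * card T) \<le> int (card B) * (int (missing_between T B) + sum g R)"
    by (intro mult_left_mono) auto
  also have "\<dots> \<le> int (card B) * int (missing_between T B) + int (card T) * (int (missing_between S B) - int (missing_between T B))"
    using R(3) sumg by (simp add: distrib_left)
  also have "\<dots> = int (card S * missing_between T B + card T * missing_between S B)"
    using card[symmetric] by (simp add: algebra_simps)
  finally show ?thesis by (simp only: of_nat_mult[symmetric] of_nat_le_iff)
qed

text \<open>The function \<open>h\<close> records the part of the budget not spent inside
  \<open>A \<union> B\<close>. By maximality no exchange of single vertices enlarges the cut; with
  the two degree bounds this gives \<open>half\<close>, so many missing arcs inside \<open>A\<close>
  force few inside \<open>B\<close>. A bad \<open>A\<close> makes all estimates tight and leaves no
  room for \<open>h\<close>.\<close>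

lemma max_cut_bad_side:
  assumes fin: "finite A" "finite B" "A \<inter> B = {}" "card A = K" "card B = K" "3 \<le> K"
    and deg: "\<And>x. x \<in> A \<union> B \<Longrightarrow> missing_deg x A + missing_deg x B + h x \<le> K"
    and max: "\<And>A' B'. A' \<union> B' = A \<union> B \<Longrightarrow> A' \<inter> B' = {} \<Longrightarrow> card A' = K \<Longrightarrow> card B' = K \<Longrightarrow> missing_between A' B' \<le> missing_between A B"
    and bad: "\<not> dense_strong A"
  shows "dense_strong B \<and> (\<forall>a\<in>A. h a = 0 \<and> missing_deg a A + 1 \<le> K)"
proof -
  have swap: "missing_deg x A + missing_deg y B + 2 * missing x y \<le> missing_deg y A + missing_deg x B"
    if "x \<in> A" "y \<in> B" for x y
  proof -
    have nin: "y \<notin> A" "x \<notin> B" using that fin by auto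
    have "card (insert y (A - {x})) = K" "card (insert x (B - {y})) = K"
      using nin that fin card_Suc_Diff1[of A x] card_Suc_Diff1[of B y] by simp_all
    then have "missing_between (insert y (A - {x})) (insert x (B - {y})) \<le> missing_between A B"
      using that nin fin(3) by (intro max) auto
    then show ?thesis using missing_between_swap[OF fin(1-3) that] by linarith
  qed
  have half: "missing_deg x A + missing_deg y B + missing x y \<le> K" if "x \<in> A" "y \<in> B" for x y
    using swap[OF that] deg[of x] deg[of y] that by auto
  have cutA: "missing_between A B = (\<Sum>a\<in>A. missing_deg a B)" unfolding missing_between_def ..
  show ?thesis
  proof (cases "\<exists>x\<in>A. K \<le> missing_deg x A + 1")
    case True
    then obtain x where x: "x \<in> A" "K \<le> missing_deg x A + 1" by blast
    have mB: "missing_deg y B \<le> 1" if "y \<in> B" for y using half[OF x(1) that] x(2) by linarith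
    have "dense_strong B" unfolding dense_strong_def
    proof (intro conjI ballI)
      show "missing_deg y B + 2 \<le> card B" if "y \<in> B" for y using mB[OF that] fin by simp
      fix y y' assume y: "y \<in> B" "y' \<in> B"
      show "(y, y') \<in> (induced_rel E B)\<^sup>*"
      proof (rule ccontr)
        assume "\<not> ?thesis"
        then obtain S T where ST: "S \<union> T = B" "S \<inter> T = {}" "y \<in> S" "y' \<in> T" "\<And>a b. a \<in> S \<Longrightarrow> b \<in> T \<Longrightarrow> \<not> E a b"
          using unreachable_cut[OF y] by metis
        have "card T \<le> 1" "card S \<le> 1"
          using cut_missing_deg(1)[OF fin(2) ST(1,2,5) ST(3)] cut_missing_deg(2)[OF fin(2) ST(1,2,5) ST(4)] mB y
          by (meson le_trans)+
        moreover have "card S + card T = K" using ST fin card_Un_disjoint[of S T] by (metis finite_Un)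
        ultimately show False using fin by linarith
      qed
    qed
    \<comment> \<open>Summing \<open>swap\<close> over \<open>B\<close> for fixed \<open>x\<close>,
      and the degree bound over \<open>A\<close>, bounds the cut from both sides. Comparison leaves
      only \<open>p = K - 1\<close>, \<open>q = 1\<close> and total \<open>h\<close> zero;
      \<open>K \<ge> 3\<close> excludes \<open>q = 0\<close>.\<close>
    moreover have "(\<Sum>a\<in>A. h a) = 0 \<and> missing_deg x A + 1 = K"
    proof -
      define p where "p = missing_deg x A"
      define q where "q = missing_deg x B"
      define H where "H = (\<Sum>a\<in>A. h a)"
      have "(\<Sum>y\<in>B. p + 2 * missing x y) \<le> (\<Sum>y\<in>B. missing_deg y A + q)"
        by (intro sum_mono) (use swap[OF x(1)] in \<open>force simp: p_def q_def\<close>)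
      then have "K * p + 2 * (\<Sum>y\<in>B. missing x y) \<le> missing_between B A + K * q"
        using fin by (simp add: sum.distrib sum_distrib_left missing_between_def)
      moreover have "(\<Sum>y\<in>B. missing x y) = q"
        unfolding q_def using fin x by (subst missing_deg_not_in) auto
      moreover have "missing_between B A = missing_between A B" using missing_between_commute[of A B] fin by simp
      ultimately have 1: "K * p + 2 * q \<le> missing_between A B + K * q" by simp
      have "(\<Sum>a\<in>A. missing_deg a A + missing_deg a B + h a) \<le> (\<Sum>a\<in>A. K)"
        by (intro sum_mono deg) auto
      then have 2: "(\<Sum>a\<in>A. missing_deg a A) + missing_between A B + H \<le> K * K"
        using fin by (simp add: sum.distrib missing_between_def H_def)
      have "(\<Sum>a\<in>A - {x}. missing a x) \<le> (\<Sum>a\<in>A - {x}. missing_deg a A)"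
        unfolding missing_deg_def using fin x by (intro sum_mono member_le_sum) auto
      moreover have "(\<Sum>a\<in>A - {x}. missing a x) = p"
        unfolding p_def missing_deg_def by (intro sum.cong refl missing_commute)
      moreover have "(\<Sum>a\<in>A. missing_deg a A) = p + (\<Sum>a\<in>A - {x}. missing_deg a A)"
        unfolding p_def using fin x by (simp add: sum.remove)
      ultimately have 3: "2 * p \<le> (\<Sum>a\<in>A. missing_deg a A)" by simp
      have pq: "p + q \<le> K" using deg[of x] x unfolding p_def q_def by auto
      have pK: "K \<le> p + 1" using x unfolding p_def by simp
      have 4: "K * p + 2 * q + 2 * p + H \<le> K * K + K * q" using 1 2 3 by linarith
      show ?thesis
      proof (cases "p = K")
        case True
        then have "q = 0" using pq by simp
        then show ?thesis using 4 True fin by simp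
      next
        case False
        then have "K = p + 1" using pq pK by linarith
        then have "q = 0 \<or> q = 1" using pq by linarith
        then show ?thesis
        proof
          assume "q = 0"
          then have "K * p + 2 * p \<le> K * K" using 4 by simp
          then show ?thesis using \<open>K = p + 1\<close> fin(6) by (simp add: algebra_simps)
        next
          assume "q = 1"
          then have "K * p + 2 + 2 * p + H \<le> K * K + K" using 4 by simp
          then show ?thesis using \<open>K = p + 1\<close> H_def p_def by (simp add: algebra_simps)
        qed
      qed
    qed
    then have "(\<forall>a\<in>A. h a = 0)" "missing_deg x A + 1 = K" using fin by auto
    moreover have "missing_deg a A + 1 \<le> K" if "a \<in> A" for a
    proof (rule ccontr)
      assume "\<not> ?thesis"
      then have a: "K \<le> missing_deg a A" by simp
      \<comment> \<open>The same comparison for \<open>a\<close>, which would have no missing arcs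
        to \<open>B\<close>.\<close>
      have "K * missing_deg a A + 2 * missing_deg a A \<le> K * K"
      proof -
        have q0: "missing_deg a B = 0" using deg[of a] a that by auto
        have "missing_deg a A \<le> missing_deg y A" if "y \<in> B" for y
          using swap[OF \<open>a \<in> A\<close> that] q0 by linarith
        then have 1: "card B * missing_deg a A \<le> missing_between B A" using fin by (intro missing_between_ge) auto
        have "(\<Sum>a\<in>A. missing_deg a A + missing_deg a B) \<le> (\<Sum>a\<in>A. K)"
          by (intro sum_mono) (use deg in fastforce)
        then have 2: "(\<Sum>a\<in>A. missing_deg a A) + missing_between A B \<le> K * K"
          using fin by (simp add: sum.distrib missing_between_def)
        have "(\<Sum>b\<in>A - {a}. missing b a) \<le> (\<Sum>b\<in>A - {a}. missing_deg b A)"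
          unfolding missing_deg_def using fin that by (intro sum_mono member_le_sum) auto
        moreover have "(\<Sum>b\<in>A - {a}. missing b a) = missing_deg a A"
          unfolding missing_deg_def by (intro sum.cong refl missing_commute)
        moreover have "(\<Sum>b\<in>A. missing_deg b A) = missing_deg a A + (\<Sum>b\<in>A - {a}. missing_deg b A)"
          using fin that by (simp add: sum.remove)
        ultimately show ?thesis using 1 2 missing_between_commute[of A B] fin by simp
      qed
      moreover have "K * K \<le> K * missing_deg a A" using a by simp
      ultimately show False using a fin by linarith
    qed
    ultimately show ?thesis by blast
  next
    case False
    then have low: "missing_deg a A + 2 \<le> K" if "a \<in> A" for a using that by force
    then obtain x x' where xx: "x \<in> A" "x' \<in> A" "(x, x') \<notin> (induced_rel E A)\<^sup>*"
      using bad fin unfolding dense_strong_def by auto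
    obtain S T where ST: "S \<union> T = A" "S \<inter> T = {}" "x \<in> S" "x' \<in> T" "\<And>a b. a \<in> S \<Longrightarrow> b \<in> T \<Longrightarrow> \<not> E a b"
      using unreachable_cut[OF xx] by metis
    define s where "s = card S"
    define t where "t = card T"
    have finST: "finite S" "finite T" using ST fin by (metis finite_Un)+
    have st: "s + t = K" using ST fin card_Un_disjoint[OF finST ST(2)] unfolding s_def t_def by simp
    have pos: "0 < s" "0 < t" using ST finST unfolding s_def t_def by (auto simp: card_gt_0_iff)
    have mS: "t \<le> missing_deg a A" if "a \<in> S" for a
      using cut_missing_deg(1)[OF fin(1) ST(1,2,5)] that unfolding t_def by blast
    have mT: "s \<le> missing_deg a A" if "a \<in> T" for a
      using cut_missing_deg(2)[OF fin(1) ST(1,2,5)] that unfolding s_def by blast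
    have "dense_strong B" unfolding dense_strong_def
    proof (intro conjI ballI)
      show "missing_deg y B + 2 \<le> card B" if "y \<in> B" for y
        using half[OF xx(1) that] half[OF xx(2) that] mS[OF ST(3)] mT[OF ST(4)] st fin by linarith
      fix y y' assume y: "y \<in> B" "y' \<in> B"
      show "(y, y') \<in> (induced_rel E B)\<^sup>*"
      proof (rule ccontr)
        assume "\<not> ?thesis"
        then obtain S' T' where ST': "S' \<union> T' = B" "S' \<inter> T' = {}" "y \<in> S'" "y' \<in> T'" "\<And>a b. a \<in> S' \<Longrightarrow> b \<in> T' \<Longrightarrow> \<not> E a b"
          using unreachable_cut[OF y] by metis
        have finST': "finite S'" "finite T'" using ST' fin by (metis finite_Un)+
        have st': "card S' + card T' = K" using ST' fin card_Un_disjoint[OF finST' ST'(2)] by simp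
        have mB: "card T' \<le> missing_deg b B" if "b \<in> S'" for b
          using cut_missing_deg(1)[OF fin(2) ST'(1,2,5)] that by blast
        have mB': "card S' \<le> missing_deg b B" if "b \<in> T'" for b
          using cut_missing_deg(2)[OF fin(2) ST'(1,2,5)] that by blast
        \<comment> \<open>If \<open>B\<close> had a cut too, \<open>half\<close> for the four pairs
          would make both cuts balanced. Then no arc is missing between \<open>A\<close> and
          \<open>B\<close>, and exchanging \<open>x\<close> with \<open>y\<close> would enlarge the
          partition's count.\<close>
        have eq: "s = t" "card S' = s" "card T' = s"
          using half[OF xx(1) y(1)] half[OF xx(1) y(2)] half[OF xx(2) y(1)] half[OF xx(2) y(2)]
            mS[OF ST(3)] mT[OF ST(4)] mB[OF ST'(3)] mB'[OF ST'(4)] st st' by linarith+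
        have big: "s \<le> missing_deg a A" if "a \<in> A" for a using mS mT ST(1) eq that by blast
        have big': "s \<le> missing_deg b B" if "b \<in> B" for b using mB mB' ST'(1) eq that by (metis UnE)
        have zero: "missing a b = 0" if "a \<in> A" "b \<in> B" for a b
          using half[OF that] big[OF that(1)] big'[OF that(2)] st eq by linarith
        have "x \<notin> B" "y \<notin> A" using xx y fin(3) by auto
        then have "missing_deg x B = 0" "missing_deg y A = 0"
          using zero y xx missing_commute[of y] by (auto simp: missing_deg_not_in)
        then show False using swap[OF xx(1) y(1)] big[OF xx(1)] pos by linarith
      qed
    qed
    moreover have "\<forall>a\<in>A. h a = 0"
    proof -
      have avg: "K * (s * t) \<le> s * missing_between T B + t * missing_between S B"
      proof -
        have "card B * (card S * card T) \<le> card S * missing_between T B + card T * missing_between S B"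
        proof (rule missing_cut_averaging[OF finST fin(2) ST(2) _ ST(5)])
          show "(S \<union> T) \<inter> B = {}" using ST fin by simp
          show "card S + card T = card B" using st fin unfolding s_def t_def by simp
          fix R assume R: "R \<subseteq> B" "card R = card T"
          have finR: "finite R" using R fin finite_subset by blast
          have dis: "S \<inter> R = {}" "T \<inter> (B - R) = {}" using ST R fin by auto
          have "card (S \<union> R) = K" using dis finST finR R st card_Un_disjoint[of S R] s_def t_def by simp
          moreover have "card (T \<union> (B - R)) = K"
            using dis finST finR R st fin card_Un_disjoint[of T "B - R"] s_def t_def by (simp add: card_Diff_subset)
          moreover have "(S \<union> R) \<union> (T \<union> (B - R)) = A \<union> B" using ST(1) R(1) by blast
          moreover have "(S \<union> R) \<inter> (T \<union> (B - R)) = {}" using ST(1,2) R(1) fin(3) by blast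
          ultimately show "missing_between (S \<union> R) (T \<union> (B - R)) \<le> missing_between (S \<union> T) B"
            using max[of "S \<union> R" "T \<union> (B - R)"] ST(1) by simp
        qed
        then show ?thesis using fin unfolding s_def t_def by simp
      qed
      have up: "missing_between P B + (\<Sum>a\<in>P. h a) \<le> card P * l"
        if P: "P \<subseteq> A" and l: "\<And>a. a \<in> P \<Longrightarrow> K \<le> missing_deg a A + l" for P l
      proof -
        have "(\<Sum>a\<in>P. missing_deg a B + h a) \<le> (\<Sum>a\<in>P. l)"
          by (intro sum_mono) (use deg l P in fastforce)
        then show ?thesis by (simp add: sum.distrib missing_between_def)
      qed
      \<comment> \<open>A vertex of \<open>S\<close> already misses \<open>t\<close> arcs inside
        \<open>A\<close>, which leaves \<open>s\<close> of its budget \<open>K\<close>;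
        symmetrically for \<open>T\<close>. Weighted by \<open>t\<close> and \<open>s\<close>, these
        upper bounds add up to exactly the lower bound \<open>avg\<close>, so nothing remains for
        \<open>h\<close>.\<close>
      have uS: "missing_between S B + (\<Sum>a\<in>S. h a) \<le> s * s"
        using up[of S s] mS ST(1) st unfolding s_def by fastforce
      have uT: "missing_between T B + (\<Sum>a\<in>T. h a) \<le> t * t"
        using up[of T t] mT ST(1) st unfolding t_def by fastforce
      have "s * (missing_between T B + (\<Sum>a\<in>T. h a)) + t * (missing_between S B + (\<Sum>a\<in>S. h a)) \<le> s * (t * t) + t * (s * s)"
        using uS uT by (intro add_mono mult_left_mono) auto
      also have "\<dots> = K * (s * t)" unfolding st[symmetric] by (simp add: algebra_simps)
      also note avg
      finally have "s * (\<Sum>a\<in>T. h a) + t * (\<Sum>a\<in>S. h a) = 0" by (simp add: algebra_simps)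
      then have "(\<Sum>a\<in>T. h a) = 0" "(\<Sum>a\<in>S. h a) = 0" using pos by auto
      then show ?thesis using finST ST(1) by auto
    qed
    ultimately show ?thesis using low by force
  qed
qed

text \<open>A partition with the most missing arcs across is taken; if one side is bad,
  \<open>max_cut_bad_side\<close> applies, with the roles exchanged if needed so that the bad side
  is called \<open>A\<close>.\<close>

lemma balanced_dichotomy:
  assumes fin: "finite W" "card W = 2 * K" "3 \<le> K"
    and deg: "\<And>x. x \<in> W \<Longrightarrow> missing_deg x W + h x \<le> K"
  shows "\<exists>A B. A \<union> B = W \<and> A \<inter> B = {} \<and> card A = K \<and> card B = K \<and> dense_strong B \<and>
    (dense_strong A \<or> (\<forall>a\<in>A. h a = 0 \<and> missing_deg a A + 1 \<le> K))"
proof -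
  define split where "split p \<longleftrightarrow> fst p \<union> snd p = W \<and> fst p \<inter> snd p = {} \<and> card (fst p) = K \<and> card (snd p) = K" for p
  obtain A0 where A0: "A0 \<subseteq> W" "card A0 = K" using fin by (metis mult_2 le_add1 obtain_subset_with_card_n)
  have "split (A0, W - A0)" using A0 fin finite_subset[OF A0(1)] unfolding split_def
    by (auto simp: card_Diff_subset)
  moreover have "missing_between (fst p) (snd p) < Suc (\<Sum>a\<in>W. missing_deg a W)" if "split p" for p
  proof -
    have "fst p \<subseteq> W" "snd p \<subseteq> W" using that unfolding split_def by auto
    then have "(\<Sum>a\<in>fst p. missing_deg a (snd p)) \<le> (\<Sum>a\<in>fst p. missing_deg a W)"
      using fin by (intro sum_mono missing_deg_mono)
    also have "\<dots> \<le> (\<Sum>a\<in>W. missing_deg a W)" using fin \<open>fst p \<subseteq> W\<close> by (intro sum_mono2) auto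
    finally show ?thesis unfolding missing_between_def by simp
  qed
  ultimately have "\<exists>p. split p \<and> (\<forall>q. split q \<longrightarrow> missing_between (fst q) (snd q) \<le> missing_between (fst p) (snd p))"
    by (intro ex_has_greatest_nat) auto
  then obtain A B where AB: "split (A, B)" and max: "\<And>q. split q \<Longrightarrow> missing_between (fst q) (snd q) \<le> missing_between A B" by force
  then have D: "A \<union> B = W" "A \<inter> B = {}" "card A = K" "card B = K" unfolding split_def by auto
  have finAB: "finite A" "finite B" using D fin by (metis finite_Un)+
  have deg': "missing_deg x A + missing_deg x B + h x \<le> K" if "x \<in> W" for x
    using deg[OF that] missing_deg_Un[OF finAB D(2)] D(1) by simp
  have max': "missing_between A' B' \<le> missing_between A B" if "A' \<union> B' = W" "A' \<inter> B' = {}" "card A' = K" "card B' = K" for A' B'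
    using max[of "(A', B')"] that unfolding split_def by auto
  show ?thesis
  proof (cases "dense_strong A")
    case True
    show ?thesis
    proof (cases "dense_strong B")
      case False
      have "dense_strong A \<and> (\<forall>a\<in>B. h a = 0 \<and> missing_deg a B + 1 \<le> K)"
      proof (rule max_cut_bad_side[OF finAB(2,1) _ D(4,3) fin(3) _ _ False])
        show "B \<inter> A = {}" using D by blast
        show "missing_deg x B + missing_deg x A + h x \<le> K" if "x \<in> B \<union> A" for x
          using deg'[of x] that D(1) by (auto simp: add.commute)
        show "missing_between A' B' \<le> missing_between B A" if "A' \<union> B' = B \<union> A" "A' \<inter> B' = {}" "card A' = K" "card B' = K" for A' B'
          using max'[of A' B'] that D missing_between_commute[OF D(2)] by (simp add: Un_commute)
      qed
      then show ?thesis using D by (intro exI[of _ B] exI[of _ A]) auto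
    qed (use D True in blast)
  next
    case False
    have "dense_strong B \<and> (\<forall>a\<in>A. h a = 0 \<and> missing_deg a A + 1 \<le> K)"
      by (rule max_cut_bad_side[OF finAB D(2-4) fin(3) _ _ False]) (use deg' max' D(1) in auto)
    then show ?thesis using D by blast
  qed
qed

lemma dense_strong_insert:
  assumes A: "finite A" "A \<noteq> {}" "u \<notin> A"
    and full: "\<And>a. a \<in> A \<Longrightarrow> missing a u = 0" and deg: "\<And>a. a \<in> A \<Longrightarrow> missing_deg a A + 1 \<le> card A"
  shows "dense_strong (insert u A)"
  unfolding dense_strong_def
proof (intro conjI ballI)
  fix x assume x: "x \<in> insert u A"
  show "missing_deg x (insert u A) + 2 \<le> card (insert u A)"
  proof (cases "x = u")
    case True
    then have "missing_deg x (insert u A) = 0"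
      using full missing_commute[of u] unfolding missing_deg_def by auto
    moreover have "card A > 0" using A by (simp add: card_gt_0_iff)
    ultimately show ?thesis using A by simp
  next
    case False
    then have "x \<in> A" using x by simp
    then have "missing_deg x (insert u A) = missing_deg x A"
      using A full missing_deg_Un[of A "{u}" x] False by (simp add: missing_deg_def)
    then show ?thesis using deg[OF \<open>x \<in> A\<close>] A by simp
  qed
next
  let ?R = "induced_rel E (insert u A)"
  have "(x, u) \<in> ?R\<^sup>*" "(u, x) \<in> ?R\<^sup>*" if "x \<in> insert u A" for x
    using that full[of x] by (auto simp: missing_eq_0_iff induced_rel_def)
  then show "(x, y) \<in> ?R\<^sup>*" if "x \<in> insert u A" "y \<in> insert u A" for x y
    using that rtrancl_trans[of x u ?R y] by blast
qed

text \<open>The budget has one arc to spare, so \<open>h\<close> can be constantly 1 and the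
  exceptional alternative is impossible.\<close>

lemma two_cycles_balanced:
  assumes W: "finite W" "card W = 2 * K" "3 \<le> K" and deg: "\<And>x. x \<in> W \<Longrightarrow> missing_deg x W + 1 \<le> K"
  shows "\<exists>C1 C2. cycle_list C1 \<and> cycle_list C2 \<and> set C1 \<subseteq> W \<and> set C2 \<subseteq> W \<and> set C1 \<inter> set C2 = {} \<and>
    card (set C1) = K \<and> card (set C2) = K"
proof -
  obtain A B where AB: "A \<union> B = W" "A \<inter> B = {}" "card A = K" "card B = K" "dense_strong B"
    and or: "dense_strong A \<or> (\<forall>a\<in>A. (1::nat) = 0 \<and> missing_deg a A + 1 \<le> K)"
    using balanced_dichotomy[OF W, of "\<lambda>_. 1"] deg by blast
  have ne: "A \<noteq> {}" "B \<noteq> {}" "finite A" "finite B" using AB W by auto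
  then have "dense_strong A" using or by auto
  then obtain C1 C2 where "cycle_list C1" "set C1 = A" "cycle_list C2" "set C2 = B"
    using dense_strong_cycle_list ne AB(5) by metis
  then show ?thesis using AB by (intro exI[of _ C1] exI[of _ C2]) auto
qed

text \<open>Here \<open>h\<close> counts the arcs missing to \<open>u\<close>. In the exceptional
  alternative \<open>u\<close> is joined to all of \<open>A\<close> in both directions, which
  repairs both reachability and the degree deficit of one.\<close>

lemma balanced_dichotomy_extra:
  assumes W: "finite W" "card W = 2 * K" "3 \<le> K" "u \<notin> W"
    and deg: "\<And>x. x \<in> W \<Longrightarrow> missing_deg x (insert u W) \<le> K"
  shows "\<exists>A B. A \<union> B = W \<and> A \<inter> B = {} \<and> card A = K \<and> card B = K \<and> dense_strong B \<and>
    (dense_strong A \<or> dense_strong (insert u A))"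
proof -
  have "missing_deg x W + missing x u \<le> K" if "x \<in> W" for x
  proof -
    have "{u} - {x} = {u}" using that W(4) by auto
    then show ?thesis using deg[OF that] missing_deg_Un[of W "{u}" x] W by (simp add: missing_deg_def)
  qed
  then obtain A B where AB: "A \<union> B = W" "A \<inter> B = {}" "card A = K" "card B = K" "dense_strong B"
    and or: "dense_strong A \<or> (\<forall>a\<in>A. missing a u = 0 \<and> missing_deg a A + 1 \<le> K)"
    using balanced_dichotomy[OF W(1-3), of "\<lambda>x. missing x u"] by blast
  have ne: "A \<noteq> {}" "finite A" "u \<notin> A" using AB W by auto
  then have "dense_strong A \<or> dense_strong (insert u A)"
    using or AB(3) dense_strong_insert[of A u] by blast
  then show ?thesis using AB by blast
qed

lemma two_cycles_balanced_extra:
  assumes W: "finite W" "card W = 2 * K" "3 \<le> K" "u \<notin> W"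
    and deg: "\<And>x. x \<in> W \<Longrightarrow> missing_deg x (insert u W) \<le> K"
  shows "\<exists>C1 C2. cycle_list C1 \<and> cycle_list C2 \<and> set C1 \<subseteq> insert u W \<and> set C2 \<subseteq> insert u W \<and> set C1 \<inter> set C2 = {} \<and>
    card (W \<inter> set C1) = K \<and> card (W \<inter> set C2) = K"
proof -
  obtain A B where AB: "A \<union> B = W" "A \<inter> B = {}" "card A = K" "card B = K" "dense_strong B"
    and or: "dense_strong A \<or> dense_strong (insert u A)"
    using balanced_dichotomy_extra[OF W deg] by blast
  have ne: "A \<noteq> {}" "B \<noteq> {}" "finite A" "finite B" using AB W by auto
  obtain C2 where C2: "cycle_list C2" "set C2 = B" using dense_strong_cycle_list[OF ne(4,2) AB(5)] by blast
  obtain C1 where C1: "cycle_list C1" "set C1 = A \<or> set C1 = insert u A"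
    using or dense_strong_cycle_list[of A] dense_strong_cycle_list[of "insert u A"] ne by blast
  have "W \<inter> set C1 = A" "W \<inter> set C2 = B" "set C1 \<inter> set C2 = {}" "set C1 \<subseteq> insert u W" "set C2 \<subseteq> insert u W"
    using C1 C2 AB W(4) by auto
  then show ?thesis using C1 C2 AB by metis
qed

text \<open>Any vertex \<open>v\<close> is set aside. Either it repairs the bad half, or both halves
  are Hamiltonian and \<open>v\<close>, missing only \<open>K < 2 * K\<close> arcs in all, can be
  inserted into one of the cycles. Both halves have size \<open>K\<close>, so it does not matter
  which one grows.\<close>

lemma two_cycles_almost_balanced:
  assumes W: "finite W" "card W = 2 * K + 1" "3 \<le> K"
    and deg: "\<And>x. x \<in> W \<Longrightarrow> missing_deg x W \<le> K"
  shows "\<exists>C1 C2. cycle_list C1 \<and> cycle_list C2 \<and> set C1 \<subseteq> W \<and> set C2 \<subseteq> W \<and> set C1 \<inter> set C2 = {} \<and>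
    card (set C1) = K \<and> card (set C2) = K + 1"
proof -
  have "W \<noteq> {}" using W by auto
  then obtain v where v: "v \<in> W" by blast
  define W' where "W' = W - {v}"
  have W': "finite W'" "card W' = 2 * K" "v \<notin> W'" "insert v W' = W" using v W unfolding W'_def by auto
  obtain A B where AB: "A \<union> B = W'" "A \<inter> B = {}" "card A = K" "card B = K" "dense_strong B"
    and or: "dense_strong A \<or> dense_strong (insert v A)"
    using balanced_dichotomy_extra[OF W'(1,2) W(3) W'(3)] deg W' by auto
  have ne: "A \<noteq> {}" "B \<noteq> {}" "finite A" "finite B" "v \<notin> A" "v \<notin> B" using AB W W' by auto
  obtain C2 where C2: "cycle_list C2" "set C2 = B" using dense_strong_cycle_list[OF ne(4,2) AB(5)] by blast
  have finish: ?thesis if "cycle_list C" "cycle_list C'" "set C = X" "set C' = insert v Y" "X \<union> Y = W'" "X \<inter> Y = {}" "card X = K" "card Y = K" for C C' X Y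
  proof -
    have "v \<notin> X" "v \<notin> Y" "finite Y" using that W' by auto
    then have "set C \<subseteq> W" "set C' \<subseteq> W" "set C \<inter> set C' = {}" "card (set C) = K" "card (set C') = K + 1"
      using that W' by auto
    then show ?thesis using that(1,2) by blast
  qed
  show ?thesis
  proof (cases "dense_strong A")
    case False
    then obtain C1 where "cycle_list C1" "set C1 = insert v A"
      using or dense_strong_cycle_list[of "insert v A"] ne by blast
    then show ?thesis using finish[of C2 C1 B A] C2 AB by (simp add: Un_commute Int_commute)
  next
    case True
    then obtain C1 where C1: "cycle_list C1" "set C1 = A" using dense_strong_cycle_list ne by metis
    have len: "length C1 = K" "length C2 = K" using C1 C2 AB unfolding cycle_list_def by (metis distinct_card)+
    have "missing_deg v A + missing_deg v B \<le> K"
      using deg[OF v] missing_deg_Un[OF ne(3,4) AB(2), of v] missing_deg_Un[of W' "{v}" v] AB(1) W'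
      by (simp add: missing_deg_def)
    then have "missing_deg v A < K \<or> missing_deg v B < K" using W(3) by linarith
    then show ?thesis
    proof
      assume "missing_deg v A < K"
      then obtain C where "cycle_list C" "set C = insert v A" using insertable[OF C1(1), of v] C1 ne len by auto
      then show ?thesis using finish[of C2 C B A] C2 AB by (simp add: Un_commute Int_commute)
    next
      assume "missing_deg v B < K"
      then obtain C where "cycle_list C" "set C = insert v B" using insertable[OF C2(1), of v] C2 ne len by auto
      then show ?thesis using finish[of C1 C A B] C1 AB by simp
    qed
  qed
qed

lemma two_cycles_relation:
  assumes fin: "finite V" and WV: "W \<subseteq> V"
    and indep: "\<And>u v. u \<in> V \<Longrightarrow> v \<in> V \<Longrightarrow> E u v \<Longrightarrow> u \<in> W \<or> v \<in> W"
    and deg: "\<And>x. x \<in> W \<Longrightarrow> missing_deg x V \<le> k"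
    and n: "2 * k + 1 \<le> card V" "card V \<le> 2 * k + 2" "3 \<le> n1" "n1 \<le> n2" "card W = n1 + n2"
  shows "\<exists>C1 C2. cycle_list C1 \<and> cycle_list C2 \<and> set C1 \<subseteq> V \<and> set C2 \<subseteq> V \<and> set C1 \<inter> set C2 = {} \<and>
     card (W \<inter> set C1) = n1 \<and> card (W \<inter> set C2) = n2"
proof (cases "n1 + k + 2 \<le> card V")
  case True
  have finW: "finite W" using fin WV finite_subset by blast
  have "\<exists>zs. cycle_list zs \<and> set zs \<subseteq> V \<and> card (W \<inter> set zs) = n1"
  proof (cases "n2 + k + 2 \<le> card V")
    case True
    show ?thesis
      by (rule cycle_with_exact_count[OF fin WV indep deg n(1) True]) (use n in auto)
  next
    case False
    have degW: "missing_deg x W \<le> k" if "x \<in> W" for x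
      using deg[OF that] missing_deg_mono[OF fin WV, of x] by simp
    \<comment> \<open>Here \<open>n2 \<ge> k\<close>, so \<open>W\<close> itself has the
      \<open>k + n1\<close> vertices required for a cycle of length \<open>n1\<close>.\<close>
    obtain zs where zs: "cycle_list zs" "set zs \<subseteq> W" "length zs = n1"
      using cycle_of_length[OF finW degW, of n1] False n by fastforce
    then have "W \<inter> set zs = set zs" "card (set zs) = n1" unfolding cycle_list_def by (auto simp: distinct_card)
    then show ?thesis using zs WV by (intro exI[of _ zs]) auto
  qed
  then show ?thesis
    by (intro two_cycles_from_cycle[OF fin WV indep deg n(1) True n(3)]) (use n in auto)
next
  case False
  have finW: "finite W" using fin WV finite_subset by blast
  have cWV: "card W \<le> card V" using card_mono[OF fin WV] .
  \<comment> \<open>Failure of the size condition gives \<open>n1 \<ge> card V - k - 1\<close>; with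
    \<open>n1 \<le> n2\<close> and \<open>n1 + n2 \<le> card V\<close> only these three cases
    remain.\<close>
  consider (odd) "n1 = k" "n2 = k" "card V = 2 * k + 1" | (odd') "n1 = k" "n2 = k + 1" "card V = 2 * k + 1"
    | (even) "n1 = k + 1" "n2 = k + 1" "card V = 2 * k + 2"
    using n False cWV by linarith
  then show ?thesis
  proof cases
    case odd
    then have "card (V - W) = 1" using n finW WV by (simp add: card_Diff_subset)
    then obtain u where u: "V - W = {u}" by (metis card_1_singletonE)
    then have V: "V = insert u W" "u \<notin> W" using WV by auto
    show ?thesis
      using two_cycles_balanced_extra[OF finW, of k u] deg odd n unfolding V(1) using V(2) by auto
  next
    case odd'
    then have V: "V = W" using card_subset_eq[OF fin WV] n by simp
    obtain C1 C2 where "cycle_list C1" "cycle_list C2" "set C1 \<subseteq> W" "set C2 \<subseteq> W" "set C1 \<inter> set C2 = {}"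
      "card (set C1) = k" "card (set C2) = k + 1"
      using two_cycles_almost_balanced[OF finW, of k] deg odd' n V by auto
    moreover from this have "W \<inter> set C1 = set C1" "W \<inter> set C2 = set C2" by auto
    ultimately show ?thesis using odd' V by metis
  next
    case even
    then have V: "V = W" using card_subset_eq[OF fin WV] n by simp
    obtain C1 C2 where "cycle_list C1" "cycle_list C2" "set C1 \<subseteq> W" "set C2 \<subseteq> W" "set C1 \<inter> set C2 = {}"
      "card (set C1) = k + 1" "card (set C2) = k + 1"
      using two_cycles_balanced[OF finW, of "k + 1"] deg even n V by auto
    moreover from this have "W \<inter> set C1 = set C1" "W \<inter> set C2 = set C2" by auto
    ultimately show ?thesis using even V by metis
  qed
qed

end

section \<open>Transfer to digraphs\<close>

lemma (in wf_digraph) awalk_of_vertex_list: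
  assumes "zs \<noteq> []" "hd zs \<in> verts G" "successively (\<lambda>x y. \<exists>e\<in>arcs G. tail G e = x \<and> head G e = y) zs"
  shows "\<exists>p. awalk (hd zs) p (last zs) \<and> awalk_verts (hd zs) p = zs"
  using assms
proof (induction zs)
  case (Cons z zs)
  show ?case
  proof (cases "zs = []")
    case True
    then show ?thesis using Cons.prems by (intro exI[of _ "[]"]) (simp add: awalk_Nil_iff)
  next
    case False
    then obtain e where e: "e \<in> arcs G" "tail G e = z" "head G e = hd zs"
      using Cons.prems by (auto simp: successively_Cons)
    then have "hd zs \<in> verts G" using head_in_verts by metis
    then obtain p where "awalk (hd zs) p (last zs)" "awalk_verts (hd zs) p = zs"
      using Cons False by (auto simp: successively_Cons)
    then show ?thesis using e False by (intro exI[of _ "e # p"]) (auto simp: awalk_Cons_iff)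
  qed
qed simp

lemma (in wf_digraph) cycle_of_vertex_list:
  assumes "zs \<noteq> []" "distinct zs" "set zs \<subseteq> verts G"
    and "successively (\<lambda>x y. \<exists>e\<in>arcs G. tail G e = x \<and> head G e = y) zs"
    and "\<exists>e\<in>arcs G. tail G e = last zs \<and> head G e = hd zs"
  shows "\<exists>p. cycle p \<and> cycle_verts G p = set zs"
proof -
  have "\<exists>p. awalk (hd (zs @ [hd zs])) p (last (zs @ [hd zs])) \<and> awalk_verts (hd (zs @ [hd zs])) p = zs @ [hd zs]"
    using assms by (intro awalk_of_vertex_list) (auto simp: successively_append_iff)
  then obtain p where p: "awalk (hd zs) p (hd zs)" "awalk_verts (hd zs) p = zs @ [hd zs]"
    using assms(1) by auto
  have ne: "p \<noteq> []" using p(2) assms(1) by auto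
  have "distinct (tl (awalk_verts (hd zs) p))" using p(2) assms(1,2) by (cases zs) auto
  then have "cycle p" unfolding cycle_def using p(1) ne by blast
  moreover have "cycle_verts G p = set zs"
    using set_awalk_verts_eq_cycle_verts[OF p(1) ne] p(2) hd_in_set[OF assms(1)] by (simp add: insert_absorb)
  ultimately show ?thesis by blast
qed

text \<open>Distinct arcs leaving \<open>x\<close> have distinct heads as there are no multiple
  arcs, and none of these heads is \<open>x\<close> as there are no loops.\<close>

lemma (in digraph) card_out_neighbours:
  "card {y \<in> verts G - {x}. \<exists>e\<in>arcs G. tail G e = x \<and> head G e = y} = out_degree G x"
proof -
  have "bij_betw (head G) (out_arcs G x) {y \<in> verts G - {x}. \<exists>e\<in>arcs G. tail G e = x \<and> head G e = y}"
  proof (rule bij_betw_imageI)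
    show "inj_on (head G) (out_arcs G x)"
      by (intro inj_onI no_multi_arcs) (simp_all add: arc_to_ends_def)
    show "head G ` out_arcs G x = {y \<in> verts G - {x}. \<exists>e\<in>arcs G. tail G e = x \<and> head G e = y}"
      by (auto simp: out_arcs_def dest: no_loops)
  qed
  from bij_betw_same_card[OF this] show ?thesis unfolding out_degree_def ..
qed

lemma (in digraph) card_in_neighbours:
  "card {y \<in> verts G - {x}. \<exists>e\<in>arcs G. tail G e = y \<and> head G e = x} = in_degree G x"
proof -
  have "bij_betw (tail G) (in_arcs G x) {y \<in> verts G - {x}. \<exists>e\<in>arcs G. tail G e = y \<and> head G e = x}"
  proof (rule bij_betw_imageI)
    show "inj_on (tail G) (in_arcs G x)"
      by (intro inj_onI no_multi_arcs) (simp_all add: arc_to_ends_def)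
    show "tail G ` in_arcs G x = {y \<in> verts G - {x}. \<exists>e\<in>arcs G. tail G e = y \<and> head G e = x}"
      by (auto simp: in_arcs_def dest: no_loops)
  qed
  from bij_betw_same_card[OF this] show ?thesis unfolding in_degree_def ..
qed

theorem theoremF:
  fixes D :: "('a, 'b) pre_digraph" and W :: "'a set" and n n\<^sub>1 n\<^sub>2 :: nat
  assumes "digraph D"
    and "card (verts D) = n"
    and "n \<ge> 6"
    and "W \<subseteq> verts D"
    and "\<And>x. x \<in> W \<Longrightarrow> real (out_degree D x + in_degree D x) \<ge> (3 * real n - 3) / 2"
    and "n\<^sub>1 \<ge> 3" and "n\<^sub>2 \<ge> 3"
    and "n\<^sub>1 + n\<^sub>2 = card W"
  shows "\<exists>C\<^sub>1 C\<^sub>2. pre_digraph.cycle D C\<^sub>1 \<and> pre_digraph.cycle D C\<^sub>2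
    \<and> cycle_verts D C\<^sub>1 \<inter> cycle_verts D C\<^sub>2 = {}
    \<and> card (cycle_verts D C\<^sub>1 \<inter> W) = n\<^sub>1
    \<and> card (cycle_verts D C\<^sub>2 \<inter> W) = n\<^sub>2"
proof -
  interpret digraph D by fact
  define arc where "arc x y \<longleftrightarrow> (\<exists>e\<in>arcs D. tail D e = x \<and> head D e = y)" for x y
  \<comment> \<open>Keeping only arcs that meet \<open>W\<close> preserves the degrees used in
    \<open>deg\<close> and provides the independence hypothesis; cycles of \<open>E\<close> are
    still cycles of \<open>D\<close>.\<close>
  define E where "E x y \<longleftrightarrow> arc x y \<and> (x \<in> W \<or> y \<in> W)" for x y
  interpret R: loopfree E
    by unfold_locales (auto simp: E_def arc_def dest: no_loops)
  let ?V = "verts D"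
  define k where "k = (n - 1) div 2"
  have fin: "finite ?V" by simp
  have indep: "u \<in> W \<or> v \<in> W" if "E u v" for u v using that unfolding E_def by blast
  have deg: "R.missing_deg x ?V \<le> k" if x: "x \<in> W" for x
  proof -
    have xV: "x \<in> ?V" using x assms(4) by blast
    have "(\<Sum>y\<in>?V - {x}. R.present x y) = (\<Sum>y\<in>?V - {x}. of_bool (arc x y)) + (\<Sum>y\<in>?V - {x}. of_bool (arc y x))"
      unfolding sum.distrib[symmetric] R.present_def E_def using x by simp
    also have "(\<Sum>y\<in>?V - {x}. of_bool (arc x y)) = out_degree D x"
      unfolding card_out_neighbours[symmetric] arc_def by (simp add: Int_def)
    also have "(\<Sum>y\<in>?V - {x}. of_bool (arc y x)) = in_degree D x"
      unfolding card_in_neighbours[symmetric] arc_def by (simp add: Int_def)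
    finally have "R.missing_deg x ?V + (out_degree D x + in_degree D x) = 2 * (n - 1)"
      using R.missing_deg_present[OF fin xV] assms(2) by simp
    moreover have "3 * (n - 1) \<le> 2 * (out_degree D x + in_degree D x)"
    proof -
      have "3 * real n - 3 \<le> 2 * real (out_degree D x + in_degree D x)"
        using assms(5)[OF x] by simp
      then show ?thesis using assms(3) by linarith
    qed
    moreover have "2 * a \<le> m" if "a + d = 2 * m" "3 * m \<le> 2 * d" for a d m :: nat
      using that by linarith
    ultimately have "2 * R.missing_deg x ?V \<le> n - 1" by blast
    from div_le_mono[OF this, of 2] show ?thesis unfolding k_def by simp
  qed
  have main: "\<exists>C1 C2. cycle C1 \<and> cycle C2 \<and> cycle_verts D C1 \<inter> cycle_verts D C2 = {} \<and>
      card (cycle_verts D C1 \<inter> W) = m1 \<and> card (cycle_verts D C2 \<inter> W) = m2"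
    if m: "3 \<le> m1" "m1 \<le> m2" "card W = m1 + m2" for m1 m2
  proof -
    have "2 * k + 1 \<le> card ?V" "card ?V \<le> 2 * k + 2" using assms(2,3) unfolding k_def by linarith+
    then obtain zs1 zs2 where zs: "R.cycle_list zs1" "R.cycle_list zs2" "set zs1 \<subseteq> ?V" "set zs2 \<subseteq> ?V"
      "set zs1 \<inter> set zs2 = {}" "card (W \<inter> set zs1) = m1" "card (W \<inter> set zs2) = m2"
      using R.two_cycles_relation[OF fin assms(4) indep deg _ _ m] by blast
    have conv: "\<exists>p. cycle p \<and> cycle_verts D p = set zs" if "R.cycle_list zs" "set zs \<subseteq> ?V" for zs
    proof (rule cycle_of_vertex_list)
      show "successively (\<lambda>x y. \<exists>e\<in>arcs D. tail D e = x \<and> head D e = y) zs"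
        by (rule successively_mono[of E]) (use that in \<open>auto simp: R.cycle_list_def E_def arc_def\<close>)
    qed (use that in \<open>auto simp: R.cycle_list_def E_def arc_def\<close>)
    show ?thesis using conv[OF zs(1,3)] conv[OF zs(2,4)] zs(5-7) by (metis Int_commute)
  qed
  show ?thesis
  proof (cases "n\<^sub>1 \<le> n\<^sub>2")
    case True
    then show ?thesis using main[of n\<^sub>1 n\<^sub>2] assms(6-8) by simp
  next
    case False
    then obtain C1 C2 where "cycle C1" "cycle C2" "cycle_verts D C1 \<inter> cycle_verts D C2 = {}"
      "card (cycle_verts D C1 \<inter> W) = n\<^sub>2" "card (cycle_verts D C2 \<inter> W) = n\<^sub>1"
      using main[of n\<^sub>2 n\<^sub>1] assms(6-8) by auto
    then show ?thesis by (metis Int_commute)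
  qed
qed

end
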